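(* Let $(D_+,D_-,D_v)$ be a virtual skein triple of oriented virtual link diagrams. If $D_+$ and $D_-$ are almost classical virtual link diagrams, then $$(A^6-d_1)\,X_{D_+}+(-A^{-6}+d_1)\,X_{D_-}=(A^6-A^{-6})\,X_{D_v}$$ in $\mathbb{Z}[A^{\pm1},d_1,d_2,\dots]$, where $X_D$ denotes the multivariable polynomial of a virtual link diagram $D$.
   Context: **Virtual link diagrams.** A virtual link diagram is a (nonempty, finite) collection of immersed oriented loops in $\mathbb{R}^2$ whose multiple points are transverse double points, each being either a classical crossing (with over/under information, and hence positive or negative in the usual sense) or a virtual crossing (no over/under information). The writhe $w(D)$ is the number of positive crossings minus the number of negative crossings of $D$. **Virtual skein triple.** A triple $(D_+,D_-,D_v)$ of virtual link diagrams such that $D_-$ is obtained from $D_+$ by a crossing change at a positive crossing $p$ of $D_+$, and $D_v$ is obtained from $D_+$ by replacing $p$ with a virtual crossing. **Alexander numberings.** A semi-arc of $D$ is an immersed arc in a component of $D$ between two (consecutive) classical crossings, or an immersed loop of $D$ missing classical crossings; semi-arcs pass through virtual crossings. An Alexander numbering of $D$ is an assignment of an integer to each semi-arc such that at each classical crossing, drawn with both strands oriented upward, there is some $i\in\mathbb{Z}$ such that the two left semi-arcs (bottom-left and top-left) are numbered $i$ and the two right semi-arcs (bottom-right and top-right) are numbered $i+1$, regardless of the sign of the crossing. $D$ is almost classical if it admits an Alexander numbering. **Cut systems.** An oriented cut point is a point on a semi-arc of $D$ (away from crossings) together with a choice of one of the two directions along the semi-arc (which need not agree with the orientation of $D$).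 A cut system of $D$ is a finite set $C$ of oriented cut points such that $D$ with $C$ admits an Alexander numbering, i.e. integers can be assigned to the pieces of semi-arcs cut at the cut points so that at each classical crossing, drawn with both strands oriented upward, there is some $i\in\mathbb{Z}$ such that the two left pieces (bottom-left and top-left) are numbered $i$ and the two right pieces (bottom-right and top-right) are numbered $i+1$ (regardless of the sign of the crossing), numbers are unchanged through virtual crossings, and the number increases by $1$ when one passes a cut point in the direction of that cut point. Every virtual link diagram has a cut system; the empty set is a cut system of an almost classical diagram. **States and indices.** At a positive crossing the A-splice is the orientation-respecting smoothing and the B-splice is the other smoothing; at a negative crossing the B-splice is the orientation-respecting smoothing and the A-splice is the other one. A state $\sigma$ of $(D,C)$ is the union of immersed loops in $\mathbb{R}^2$, with virtual crossings and oriented cut points, obtained by choosing an A- or B-splice at every classical crossing of $D$. For a loop $\ell$ of a state, its index $\iota(\ell)\ge 0$ is determined by: virtual crossings are ignored; two adjacent cut points of $\ell$ with opposite directions along $\ell$ may be cancelled; a loop with $2r$ cut points all in the same direction along the loop has index $r$. Equivalently, $\iota(\ell)$ is half the absolute value of the number of cut points of $\ell$ pointing in one direction along $\ell$ minus the number pointing in the other direction (this difference is always even). Let $\natural\sigma$ be the number of A-splices minus the number of B-splices used to obtain $\sigma$, $\sharp\sigma$ the number of loops of $\sigma$, and $\tau_i(\sigma)$ the number of loops of $\sigma$ of index $i$. **The polynomial.** The double bracket is $$\langle\!\langle D,C\rangle\!\rangle=\sum_{\sigma}A^{\natural\sigma}(-A^2-A^{-2})^{\sharp\sigma-1}d_1^{\tau_1(\sigma)}d_2^{\tau_2(\sigma)}\cdots\in\mathbb{Z}[A^{\pm1},d_1,d_2,\dots],$$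 the sum running over all states $\sigma$ of $(D,C)$. It is known (N. Kamada) not to depend on the choice of the cut system $C$, so write $\langle\!\langle D\rangle\!\rangle$. The multivariable polynomial of $D$ is $X_D=(-A^3)^{-w(D)}\langle\!\langle D\rangle\!\rangle$; it is an invariant of virtual links. *)

theory Defs
  imports
    "HOL-Analysis.Analysis"
    "HOL-Combinatorics.Orbits"
    "HOL-Library.Poly_Mapping"
    "HOL-Library.Product_Plus"
begin

section \<open>Virtual link diagrams\<close>

text \<open>
  A loop is a 1-periodic curve, oriented by its parametrization.  A point \<open>(k, t)\<close>, with
  \<open>0 \<le> t < 1\<close>, is the point with parameter \<open>t\<close> of the domain circle of the \<open>k\<close>-th loop, so a
  double point of a diagram is a pair of distinct points with the same position in the plane.
\<close>

type_synonym point = "nat \<times> real"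

text \<open>
  A classical crossing is the pair \<open>(over, under)\<close> of its points; the double points not listed
  in \<open>classical\<close> are the virtual crossings.
\<close>

type_synonym crossing = "point \<times> point"

record diagram =
  curves :: "(real \<Rightarrow> real \<times> real) list"
  classical :: "crossing set"

definition immersed_loop :: "(real \<Rightarrow> real \<times> real) \<Rightarrow> bool" where
  "immersed_loop \<gamma> \<longleftrightarrow>
     \<gamma> C1_differentiable_on UNIV \<and>
     (\<forall>t. vector_derivative \<gamma> (at t) \<noteq> 0) \<and>
     (\<forall>t. \<gamma> (t + 1) = \<gamma> t)"

definition points :: "diagram \<Rightarrow> point set" where
  "points D = {..<length (curves D)} \<times> {0..<1}"

definition position :: "diagram \<Rightarrow> point \<Rightarrow> real \<times> real" where
  "position D p = (curves D ! fst p) (snd p)"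

definition tangent :: "diagram \<Rightarrow> point \<Rightarrow> real \<times> real" where
  "tangent D p = vector_derivative (curves D ! fst p) (at (snd p))"

text \<open>
  \<open>cross2 u v\<close> is positive iff \<open>v\<close> is obtained by turning \<open>u\<close> counterclockwise by an angle
  strictly between 0 and 180 degrees (up to scaling).
\<close>

definition cross2 :: "real \<times> real \<Rightarrow> real \<times> real \<Rightarrow> real" where
  "cross2 u v = fst u * snd v - snd u * fst v"

definition double_points :: "diagram \<Rightarrow> (point \<times> point) set" where
  "double_points D =
     {(p, q). p \<in> points D \<and> q \<in> points D \<and> p \<noteq> q \<and> position D p = position D q}"

definition virtual_link_diagram :: "diagram \<Rightarrow> bool" where
  "virtual_link_diagram D \<longleftrightarrow>
     curves D \<noteq> [] \<and>
     (\<forall>\<gamma> \<in> set (curves D). immersed_loop \<gamma>) \<and>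
     finite (double_points D) \<and>
     (\<forall>p q r. (p, q) \<in> double_points D \<longrightarrow> (p, r) \<in> double_points D \<longrightarrow> q = r) \<and>
     (\<forall>(p, q) \<in> double_points D. cross2 (tangent D p) (tangent D q) \<noteq> 0) \<and>
     classical D \<subseteq> double_points D \<and>
     (\<forall>(p, q) \<in> classical D. (q, p) \<notin> classical D)"

text \<open>
  With both strands oriented upward, the strand going from bottom left to top right is the one
  whose tangent has positive \<open>cross2\<close> with the other one; the crossing is positive iff this is
  the over-strand.
\<close>

definition positive :: "diagram \<Rightarrow> crossing \<Rightarrow> bool" where
  "positive D c \<longleftrightarrow> cross2 (tangent D (fst c)) (tangent D (snd c)) > 0"

definition writhe :: "diagram \<Rightarrow> int" where
  "writhe D =
     int (card {c \<in> classical D. positive D c}) - int (card {c \<in> classical D. \<not> positive D c})"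

definition virtual_skein_triple :: "diagram \<Rightarrow> diagram \<Rightarrow> diagram \<Rightarrow> bool" where
  "virtual_skein_triple Dp Dm Dv \<longleftrightarrow>
     virtual_link_diagram Dp \<and> virtual_link_diagram Dm \<and> virtual_link_diagram Dv \<and>
     (\<exists>p q. (p, q) \<in> classical Dp \<and> positive Dp (p, q) \<and>
        Dm = Dp\<lparr>classical := insert (q, p) (classical Dp - {(p, q)})\<rparr> \<and>
        Dv = Dp\<lparr>classical := classical Dp - {(p, q)}\<rparr>)"


section \<open>Semi-arcs and Alexander numberings\<close>

text \<open>
  A finite set \<open>M\<close> of points (the marks) cuts the loops into pieces: \<open>Whole k\<close> is the \<open>k\<close>-th
  loop if it carries no mark, and \<open>From p\<close> is the arc that starts at the mark \<open>p\<close>, follows the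
  orientation, and ends at the next mark (which is \<open>p\<close> again if \<open>p\<close> is the only mark on its loop).
\<close>

datatype piece = Whole nat | From point

definition pieces :: "diagram \<Rightarrow> point set \<Rightarrow> piece set" where
  "pieces D M = {Whole k | k. k < length (curves D) \<and> k \<notin> fst ` M} \<union> From ` M"

text \<open>Parameter distance from \<open>p\<close> forward to \<open>q\<close> on the same loop, with values in \<open>]0, 1]\<close>.\<close>

definition gap :: "point \<Rightarrow> point \<Rightarrow> real" where
  "gap p q = (if snd p = snd q then 1 else frac (snd q - snd p))"

definition next_mark :: "point set \<Rightarrow> point \<Rightarrow> point" where
  "next_mark M p = arg_min (\<lambda>q. gap p q) (\<lambda>q. q \<in> M \<and> fst q = fst p)"

definition prev_mark :: "point set \<Rightarrow> point \<Rightarrow> point" where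
  "prev_mark M p = arg_min (\<lambda>q. gap q p) (\<lambda>q. q \<in> M \<and> fst q = fst p)"

text \<open>The piece that contains \<open>p\<close> if \<open>p\<close> is not a mark, and the piece that ends at \<open>p\<close> if it is.\<close>

definition piece_to :: "point set \<Rightarrow> point \<Rightarrow> piece" where
  "piece_to M p = (if fst p \<in> fst ` M then From (prev_mark M p) else Whole (fst p))"

definition classical_points :: "diagram \<Rightarrow> point set" where
  "classical_points D = fst ` classical D \<union> snd ` classical D"

definition semi_arcs :: "diagram \<Rightarrow> piece set" where
  "semi_arcs D = pieces D (classical_points D)"

text \<open>
  An oriented cut point is a point with a direction, \<open>True\<close> being the direction that agrees with
  the orientation of the diagram.
\<close>

type_synonym cut_point = "point \<times> bool"

definition cut_points :: "diagram \<Rightarrow> cut_point set \<Rightarrow> bool" where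
  "cut_points D C \<longleftrightarrow>
     finite C \<and> fst ` C \<subseteq> points D - fst ` double_points D \<and> inj_on fst C"

definition cut_sign :: "cut_point \<Rightarrow> int" where
  "cut_sign c = (if snd c then 1 else - 1)"

text \<open>
  At a classical crossing, drawn with both strands oriented upward, \<open>a\<close> is the point on the
  strand from bottom left to top right and \<open>b\<close> the one on the strand from bottom right to top
  left.  Hence the left pieces are the one ending at \<open>a\<close> and the one starting at \<open>b\<close>.
\<close>

definition alexander_numbering :: "diagram \<Rightarrow> cut_point set \<Rightarrow> (piece \<Rightarrow> int) \<Rightarrow> bool" where
  "alexander_numbering D C f \<longleftrightarrow>
     (let M = classical_points D \<union> fst ` C in
       (\<forall>(p, q) \<in> classical D.
          let (a, b) = (if positive D (p, q) then (p, q) else (q, p)) in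
          \<exists>i. f (piece_to M a) = i \<and> f (From b) = i \<and>
              f (piece_to M b) = i + 1 \<and> f (From a) = i + 1) \<and>
       (\<forall>c \<in> C. f (From (fst c)) = f (piece_to M (fst c)) + cut_sign c))"

definition almost_classical :: "diagram \<Rightarrow> bool" where
  "almost_classical D \<longleftrightarrow> (\<exists>f. alexander_numbering D {} f)"

definition cut_system :: "diagram \<Rightarrow> cut_point set \<Rightarrow> bool" where
  "cut_system D C \<longleftrightarrow> cut_points D C \<and> (\<exists>f. alexander_numbering D C f)"


section \<open>States\<close>

datatype splice = A_splice | B_splice

type_synonym state = "crossing \<Rightarrow> splice"

definition states :: "diagram \<Rightarrow> state set" where
  "states D = classical D \<rightarrow>\<^sub>E {A_splice, B_splice}"

definition oriented_splice :: "diagram \<Rightarrow> state \<Rightarrow> crossing \<Rightarrow> bool" where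
  "oriented_splice D \<sigma> c \<longleftrightarrow> \<sigma> c = (if positive D c then A_splice else B_splice)"

definition crossing_at :: "diagram \<Rightarrow> point \<Rightarrow> crossing" where
  "crossing_at D p = (THE c. c \<in> classical D \<and> (p = fst c \<or> p = snd c))"

definition partner :: "diagram \<Rightarrow> point \<Rightarrow> point" where
  "partner D p = (if p = fst (crossing_at D p) then snd (crossing_at D p) else fst (crossing_at D p))"

text \<open>
  A directed semi-arc is a semi-arc with a direction of travel, \<open>True\<close> being along the orientation
  of the diagram.  \<open>travel D \<sigma>\<close> maps a directed semi-arc to the one that follows it on its loop of
  the state \<open>\<sigma>\<close>: one arrives at the point \<open>x\<close> of a crossing and leaves from the other point \<open>y\<close> of
  it.  The orientation-respecting smoothing joins the semi-arc ending at \<open>x\<close> to the one starting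
  at \<open>y\<close> and vice versa, so the direction of travel relative to the orientation is kept; the other
  smoothing joins the two semi-arcs ending at the crossing, and the two starting there, so that
  direction is reversed.
\<close>

fun travel :: "diagram \<Rightarrow> state \<Rightarrow> piece \<times> bool \<Rightarrow> piece \<times> bool" where
  "travel D \<sigma> (Whole k, along) = (Whole k, along)"
| "travel D \<sigma> (From p, along) =
     (let M = classical_points D;
          x = (if along then next_mark M p else p);
          y = partner D x;
          along' = (if oriented_splice D \<sigma> (crossing_at D x) then along else \<not> along)
      in if along' then (From y, True) else (piece_to M y, False))"

text \<open>
  A loop of a state is represented by the set of the semi-arcs it consists of.
\<close>

definition state_loops :: "diagram \<Rightarrow> state \<Rightarrow> piece set set" where
  "state_loops D \<sigma> = {fst ` orbit (travel D \<sigma>) (s, True) | s. s \<in> semi_arcs D}"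

text \<open>Number of cut points on a directed semi-arc, counted with sign relative to the direction of travel.\<close>

definition cut_count :: "diagram \<Rightarrow> cut_point set \<Rightarrow> piece \<times> bool \<Rightarrow> int" where
  "cut_count D C sa =
     (if snd sa then 1 else - 1) *
     (\<Sum>c \<in> {c \<in> C. piece_to (classical_points D) (fst c) = fst sa}. cut_sign c)"

text \<open>
  The loop is traversed once, starting with one of its semi-arcs; the choice of the starting
  semi-arc only affects the sense of the traversal, hence not the absolute value.
\<close>

definition loop_index :: "diagram \<Rightarrow> cut_point set \<Rightarrow> state \<Rightarrow> piece set \<Rightarrow> nat" where
  "loop_index D C \<sigma> l =
     nat \<bar>\<Sum>sa \<in> orbit (travel D \<sigma>) (SOME s. s \<in> l, True). cut_count D C sa\<bar> div 2"

definition splice_balance :: "diagram \<Rightarrow> state \<Rightarrow> int" where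
  "splice_balance D \<sigma> =
     int (card {c \<in> classical D. \<sigma> c = A_splice}) - int (card {c \<in> classical D. \<sigma> c = B_splice})"

definition index_number :: "diagram \<Rightarrow> cut_point set \<Rightarrow> state \<Rightarrow> nat \<Rightarrow> nat" where
  "index_number D C \<sigma> i = card {l \<in> state_loops D \<sigma>. loop_index D C \<sigma> l = i}"


section \<open>The multivariable polynomial\<close>

text \<open>
  The ring \<open>\<int>[A\<^sup>\<plusminus>\<^sup>1, d\<^sub>1, d\<^sub>2, \<dots>]\<close> is the monoid ring over the integers of the monoid of monomials.
  The monomial \<open>(n, m)\<close> stands for the product of \<open>A\<^sup>n\<close> and of all \<open>d\<^sub>i\<close> to the power
  \<open>lookup m (i - 1)\<close>, \<open>i \<ge> 1\<close>: the shift by one makes the variables start at index 1.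
\<close>

type_synonym mv_poly = "(int \<times> (nat \<Rightarrow>\<^sub>0 nat)) \<Rightarrow>\<^sub>0 int"

definition A_pow :: "int \<Rightarrow> mv_poly" where
  "A_pow n = Poly_Mapping.single (n, 0) 1"

definition d :: "nat \<Rightarrow> mv_poly" where
  "d i = Poly_Mapping.single (0, Poly_Mapping.single (i - 1) 1) 1"

lemma A_pow_0: "A_pow 0 = 1"
  by (simp add: A_pow_def flip: zero_prod_def)

lemma A_pow_add: "A_pow (m + n) = A_pow m * A_pow n"
  by (simp add: A_pow_def mult_single)

definition state_term :: "diagram \<Rightarrow> cut_point set \<Rightarrow> state \<Rightarrow> mv_poly" where
  "state_term D C \<sigma> =
     A_pow (splice_balance D \<sigma>) * (- A_pow 2 - A_pow (- 2)) ^ (card (state_loops D \<sigma>) - 1) *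
     (\<Prod>i \<in> {i. 1 \<le> i \<and> index_number D C \<sigma> i \<noteq> 0}. d i ^ index_number D C \<sigma> i)"

definition double_bracket :: "diagram \<Rightarrow> cut_point set \<Rightarrow> mv_poly" where
  "double_bracket D C = (\<Sum>\<sigma> \<in> states D. state_term D C \<sigma>)"

text \<open>\<open>(-A\<^sup>3)\<^sup>n\<close> for an integer \<open>n\<close>; the inverse of \<open>-A\<^sup>3\<close> is \<open>-A\<^sup>-\<^sup>3\<close>.\<close>

definition minus_A3_pow :: "int \<Rightarrow> mv_poly" where
  "minus_A3_pow n = (if 0 \<le> n then (- A_pow 3) ^ nat n else (- A_pow (- 3)) ^ nat (- n))"

text \<open>
  Every virtual link diagram has a cut system and the double bracket does not depend on it
  (N. Kamada), so the polynomial is defined with an arbitrary one.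
\<close>

definition multivariable_polynomial :: "diagram \<Rightarrow> mv_poly" where
  "multivariable_polynomial D =
     minus_A3_pow (- writhe D) * double_bracket D (SOME C. cut_system D C)"

end

theory Submission
  imports Defs
begin

text \<open>
  Expand both sides over the states \<open>\<tau>\<close> of \<open>Dv\<close>; the remaining choice is the splice at the crossing
  \<open>{p, q}\<close>.  An Alexander numbering of \<open>Dp\<close>, reduced modulo 2, orients the semi-arcs so that every
  splice of every crossing respects the orientations (source-sink orientation).  Cutting the loops of
  a state open at \<open>{p, q}\<close> therefore leaves two paths that can be matched in only two ways: in one, the
  orientation-respecting splice has one loop more than the virtual crossing and the other splice
  equally many; in the other, these roles are exchanged.

  The index of a loop does not depend on the cut system, since two numberings differ by a function that
  is constant at each crossing.  All loops of \<open>Dp\<close> and \<open>Dm\<close> have index 0.  In \<open>Dv\<close>, the numbering of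
  \<open>Dp\<close> jumps only at \<open>p\<close> and \<open>q\<close>, by 1 and -1 along the orientation; so all indices are 0 in the
  first case, and in the second one exactly the loop through the virtual crossing has index 1.  The
  contributions of \<open>\<tau>\<close> to the brackets of \<open>Dp\<close>, \<open>Dm\<close>, \<open>Dv\<close> are hence proportional to
  \<open>(-A\<^sup>3, -A\<^sup>-\<^sup>3, 1)\<close> or to \<open>(-A\<^sup>-\<^sup>3, -A\<^sup>3, d\<^sub>1)\<close>, and both triples satisfy the identity.
\<close>

section \<open>Marks on loops\<close>

text \<open>The diagrams \<open>Dp\<close> and \<open>Dv\<close> have different semi-arcs, since
  \<open>p\<close> and \<open>q\<close> are interior points of semi-arcs of \<open>Dv\<close>. Their
  states are therefore first compared on the marks of \<open>Dp\<close>, where a virtual crossing is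
  a mark that is passed straight through; such marks are erased afterwards without changing the
  number of loops. Loops are components of a graph on the pieces, so they can be counted by adding
  edges.

  Four ends of pieces meet at the crossing, which leaves three conceivable matchings by the two
  outside paths. In the source-sink orientation both ends of one strand enter the crossing and both
  ends of the other leave it; this excludes the matching that would close each strand up on itself.
  If the path from the piece ending at \<open>q\<close> leads to the piece ending at
  \<open>p\<close>, the virtual loop passes \<open>p\<close> and \<open>q\<close> in opposite
  senses. The jumps 1 and -1 then reinforce each other to 2 or -2, and halving gives index
  1.\<close>

definition marks :: "point set \<Rightarrow> bool" where
  "marks M \<longleftrightarrow> finite M \<and> snd ` M \<subseteq> {0..<1}"

lemma marks_finite: "marks M \<Longrightarrow> finite M"
  by (simp add: marks_def)

lemma marks_bounds: "marks M \<Longrightarrow> x \<in> M \<Longrightarrow> 0 \<le> snd x \<and> snd x < 1"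
  by (auto simp: marks_def)

lemma marks_subset: "marks B \<Longrightarrow> A \<subseteq> B \<Longrightarrow> marks A"
  by (auto simp: marks_def intro: finite_subset)

section \<open>Cyclic distances and neighbouring marks\<close>

lemma gap_eq:
  assumes "0 \<le> snd p" "snd p < 1" "0 \<le> snd q" "snd q < 1"
  shows "gap p q = (if snd p < snd q then snd q - snd p else snd q - snd p + 1)"
proof -
  have "frac (snd q - snd p) = (if snd p \<le> snd q then snd q - snd p else snd q - snd p + 1)"
    using assms by (auto simp: frac_unique_iff frac_eq)
  then show ?thesis by (auto simp: gap_def)
qed

text \<open>Here \<open>q\<close> lies on the way from \<open>p\<close> to \<open>r\<close>. Equal
  parameters of \<open>p\<close> and \<open>q\<close> must be excluded because \<open>gap\<close> is
  1, not 0, there.\<close>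

lemma gap_add:
  assumes "0 \<le> snd p" "snd p < 1" "0 \<le> snd q" "snd q < 1" "0 \<le> snd r" "snd r < 1"
    and "gap q r \<le> gap p r" "snd p \<noteq> snd q"
  shows "gap p r = gap p q + gap q r"
  using assms by (auto simp: gap_eq split: if_splits)

lemma next_mark_props:
  assumes "marks M" "\<exists>y\<in>M. fst y = fst p"
  shows "next_mark M p \<in> M" "fst (next_mark M p) = fst p"
    and "\<And>q. q \<in> M \<Longrightarrow> fst q = fst p \<Longrightarrow> gap p (next_mark M p) \<le> gap p q"
proof -
  let ?S = "{q \<in> M. fst q = fst p}"
  have fin: "finite ?S" and ne: "?S \<noteq> {}"
    using assms by (auto simp: marks_def)
  have eq: "next_mark M p = arg_min_on (gap p) ?S"
    by (simp add: next_mark_def arg_min_on_def)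
  show "next_mark M p \<in> M" "fst (next_mark M p) = fst p"
    using arg_min_if_finite(1)[OF fin ne, of "gap p"] by (auto simp: eq)
  show "gap p (next_mark M p) \<le> gap p q" if "q \<in> M" "fst q = fst p" for q
    using arg_min_least[OF fin ne, of q "gap p"] that by (auto simp: eq)
qed

lemma prev_mark_props:
  assumes "marks M" "\<exists>y\<in>M. fst y = fst p"
  shows "prev_mark M p \<in> M" "fst (prev_mark M p) = fst p"
    and "\<And>q. q \<in> M \<Longrightarrow> fst q = fst p \<Longrightarrow> gap (prev_mark M p) p \<le> gap q p"
proof -
  let ?S = "{q \<in> M. fst q = fst p}"
  have fin: "finite ?S" and ne: "?S \<noteq> {}"
    using assms by (auto simp: marks_def)
  have eq: "prev_mark M p = arg_min_on (\<lambda>q. gap q p) ?S"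
    by (simp add: prev_mark_def arg_min_on_def)
  show "prev_mark M p \<in> M" "fst (prev_mark M p) = fst p"
    using arg_min_if_finite(1)[OF fin ne, of "\<lambda>q. gap q p"] by (auto simp: eq)
  show "gap (prev_mark M p) p \<le> gap q p" if "q \<in> M" "fst q = fst p" for q
    using arg_min_least[OF fin ne, of q "\<lambda>q. gap q p"] that by (auto simp: eq)
qed

text \<open>A value of \<open>gap p\<close> determines the parameter in [0, 1), so on one loop there
  is only one minimiser for \<open>arg_min\<close> to choose.\<close>

lemma next_mark_unique:
  assumes "marks M" "0 \<le> snd p" "snd p < 1" "y \<in> M" "fst y = fst p"
    and "\<And>q. q \<in> M \<Longrightarrow> fst q = fst p \<Longrightarrow> gap p y \<le> gap p q"
  shows "next_mark M p = y"
proof -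
  let ?z = "next_mark M p"
  have ex: "\<exists>y\<in>M. fst y = fst p" using assms(4,5) by blast
  have z: "?z \<in> M" "fst ?z = fst p"
    using next_mark_props(1,2)[OF assms(1) ex] .
  have le: "gap p ?z \<le> gap p y" "gap p y \<le> gap p ?z"
    using next_mark_props(3)[OF assms(1) ex assms(4,5)] assms(6)[OF z] .
  have "snd ?z = snd y"
    using le gap_eq[of p ?z] gap_eq[of p y] assms(2,3)
      marks_bounds[OF assms(1,4)] marks_bounds[OF assms(1) z(1)] by (auto split: if_splits)
  then show ?thesis
    using z assms by (simp add: prod_eq_iff)
qed

lemma prev_mark_unique:
  assumes "marks M" "0 \<le> snd p" "snd p < 1" "y \<in> M" "fst y = fst p"
    and "\<And>q. q \<in> M \<Longrightarrow> fst q = fst p \<Longrightarrow> gap y p \<le> gap q p"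
  shows "prev_mark M p = y"
proof -
  let ?z = "prev_mark M p"
  have ex: "\<exists>y\<in>M. fst y = fst p" using assms(4,5) by blast
  have z: "?z \<in> M" "fst ?z = fst p"
    using prev_mark_props(1,2)[OF assms(1) ex] .
  have le: "gap ?z p \<le> gap y p" "gap y p \<le> gap ?z p"
    using prev_mark_props(3)[OF assms(1) ex assms(4,5)] assms(6)[OF z] .
  have "snd ?z = snd y"
    using le gap_eq[of ?z p] gap_eq[of y p] assms(2,3)
      marks_bounds[OF assms(1,4)] marks_bounds[OF assms(1) z(1)] by (auto split: if_splits)
  then show ?thesis
    using z assms by (simp add: prod_eq_iff)
qed

lemma prev_mark_in [simp]: "marks M \<Longrightarrow> x \<in> M \<Longrightarrow> prev_mark M x \<in> M"
  and next_mark_in [simp]: "marks M \<Longrightarrow> x \<in> M \<Longrightarrow> next_mark M x \<in> M"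
  and fst_prev_mark [simp]: "marks M \<Longrightarrow> x \<in> M \<Longrightarrow> fst (prev_mark M x) = fst x"
  and fst_next_mark [simp]: "marks M \<Longrightarrow> x \<in> M \<Longrightarrow> fst (next_mark M x) = fst x"
  by (rule prev_mark_props next_mark_props; blast)+

text \<open>The value \<open>gap x x\<close> is 1, larger than the distance from any other mark, so
  it is minimal only on a loop with a single mark.\<close>

lemma prev_mark_self:
  assumes "marks M" "x \<in> M" "prev_mark M x = x" "y \<in> M" "fst y = fst x"
  shows "y = x"
proof -
  have "gap x x \<le> gap y x"
    using prev_mark_props(3)[OF assms(1), of x y] assms by metis
  then have "snd y = snd x"
    using marks_bounds[OF assms(1,2)] marks_bounds[OF assms(1,4)]
    by (auto simp: gap_eq split: if_splits)
  then show ?thesis using assms(5) by (simp add: prod_eq_iff)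
qed

lemma next_prev_mark [simp]:
  assumes "marks M" "x \<in> M"
  shows "next_mark M (prev_mark M x) = x"
proof (rule next_mark_unique)
  let ?y = "prev_mark M x"
  show "gap ?y x \<le> gap ?y q" if "q \<in> M" "fst q = fst ?y" for q
    using prev_mark_props(3)[OF assms(1), of x q] that assms gap_eq[of ?y x] gap_eq[of ?y q]
      gap_eq[of q x] marks_bounds[OF assms(1), of ?y] marks_bounds[OF assms(1), of q]
      marks_bounds[OF assms(1), of x]
    by (auto split: if_splits)
qed (use assms marks_bounds[OF assms(1), of "prev_mark M x"] in auto)

lemma prev_next_mark [simp]:
  assumes "marks M" "x \<in> M"
  shows "prev_mark M (next_mark M x) = x"
proof (rule prev_mark_unique)
  let ?y = "next_mark M x"
  show "gap x ?y \<le> gap q ?y" if "q \<in> M" "fst q = fst ?y" for q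
    using next_mark_props(3)[OF assms(1), of x q] that assms gap_eq[of x ?y] gap_eq[of q ?y]
      gap_eq[of x q] marks_bounds[OF assms(1), of ?y] marks_bounds[OF assms(1), of q]
      marks_bounds[OF assms(1), of x]
    by (auto split: if_splits)
qed (use assms marks_bounds[OF assms(1), of "next_mark M x"] in auto)

text \<open>Walking back from \<open>m\<close> to a mark of the coarse set \<open>A\<close>, one
  meets a mark of the fine set \<open>B\<close> no later. The point \<open>m\<close> itself need not
  be a mark.\<close>

lemma prev_mark_subset:
  assumes "marks B" "A \<subseteq> B" "0 \<le> snd m" "snd m < 1" "\<exists>y\<in>A. fst y = fst m"
  shows "prev_mark A m =
    (if prev_mark B m \<in> A then prev_mark B m else prev_mark A (prev_mark B m))"
proof -
  have A: "marks A" using assms marks_subset by blast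
  let ?b = "prev_mark B m"
  have b: "?b \<in> B" "fst ?b = fst m" "\<And>q. q \<in> B \<Longrightarrow> fst q = fst m \<Longrightarrow> gap ?b m \<le> gap q m"
    using prev_mark_props[OF assms(1), of m] assms(2,5) by blast+
  show ?thesis
  proof (cases "?b \<in> A")
    case True
    then show ?thesis using assms A b by (auto intro!: prev_mark_unique)
  next
    case False
    let ?y = "prev_mark A ?b"
    have y: "?y \<in> A" "fst ?y = fst m" "\<And>q. q \<in> A \<Longrightarrow> fst q = fst m \<Longrightarrow> gap ?y ?b \<le> gap q ?b"
      using prev_mark_props[OF A, of ?b] assms(5) b by metis+
    \<comment> \<open>The mark \<open>?b\<close> lies between any coarse mark and \<open>m\<close>,
      so distances to \<open>m\<close> exceed distances to \<open>?b\<close> by the constant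
      \<open>gap ?b m\<close>.\<close>
    have "gap ?y m \<le> gap q m" if q: "q \<in> A" "fst q = fst m" for q
    proof -
      have "snd q \<noteq> snd ?b" "snd ?y \<noteq> snd ?b"
        using q b y False by (auto simp: prod_eq_iff) (metis prod.collapse)+
      moreover have "q \<in> B" "?y \<in> B" using q(1) y(1) assms(2) by blast+
      ultimately show ?thesis
        using gap_add[of q ?b m] gap_add[of ?y ?b m] b(3)[of q] b(3)[of ?y] y(1,2) y(3)[OF q] q
          assms(3,4) marks_bounds[OF A q(1)] marks_bounds[OF A y(1)] marks_bounds[OF assms(1) b(1)]
        by simp
    qed
    then have "prev_mark A m = ?y"
      using assms A y by (intro prev_mark_unique) auto
    then show ?thesis using False by simp
  qed
qed

lemma piece_to_subset:
  assumes "marks B" "A \<subseteq> B" "0 \<le> snd m" "snd m < 1" "\<exists>y\<in>B. fst y = fst m"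
  shows "piece_to A m =
    (if prev_mark B m \<in> A then From (prev_mark B m) else piece_to A (prev_mark B m))"
proof -
  have fst_prev: "fst (prev_mark B m) = fst m"
    using prev_mark_props(2)[OF assms(1)] assms(5) by auto
  show ?thesis
  proof (cases "\<exists>y\<in>A. fst y = fst m")
    case True
    then show ?thesis
      using prev_mark_subset[OF assms(1-4) True] fst_prev by (auto simp: piece_to_def image_iff)
  next
    case False
    then show ?thesis
      using fst_prev by (auto simp: piece_to_def image_iff)
  qed
qed

lemma piece_to_mark: "x \<in> M \<Longrightarrow> piece_to M x = From (prev_mark M x)"
  by (auto simp: piece_to_def)

text \<open>Provides places for cut points: with \<open>Z\<close> the set of all double points, a
  point so soon after \<open>x\<close> that no double point lies in between.\<close>

lemma ex_point_after:
  assumes "marks Z" "x \<in> Z"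
  shows "\<exists>x'. x' \<notin> Z \<and> fst x' = fst x \<and> 0 \<le> snd x' \<and> snd x' < 1 \<and> prev_mark Z x' = x"
proof -
  \<comment> \<open>The later parameters on the loop, with 1 as a sentinel for the end of the
    parameter interval. The new point is taken halfway to their minimum.\<close>
  define T where "T = insert 1 {snd z | z. z \<in> Z \<and> fst z = fst x \<and> snd x < snd z}"
  have "{snd z | z. z \<in> Z \<and> fst z = fst x \<and> snd x < snd z} \<subseteq> snd ` Z" by blast
  then have fin: "finite T" unfolding T_def
    using assms by (auto simp: marks_def intro: finite_subset)
  define t where "t = (snd x + Min T) / 2"
  have xb: "0 \<le> snd x" "snd x < 1" using marks_bounds[OF assms] by auto
  have "snd x < Min T" using fin xb by (subst Min_gr_iff) (auto simp: T_def)
  moreover have "Min T \<le> 1" using fin by (auto simp: T_def)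
  ultimately have t: "snd x < t" "t < Min T" "0 \<le> t" "t < 1" using xb by (auto simp: t_def)
  have above: "t < snd z" if "z \<in> Z" "fst z = fst x" "snd x < snd z" for z
  proof -
    have "Min T \<le> snd z" using fin that unfolding T_def by (intro Min_le) blast+
    then show ?thesis using t by simp
  qed
  have "prev_mark Z (fst x, t) = x"
  proof (rule prev_mark_unique)
    show "gap x (fst x, t) \<le> gap q (fst x, t)" if "q \<in> Z" "fst q = fst (fst x, t)" for q
      using above[of q] that t xb marks_bounds[OF assms(1) that(1)]
      by (cases "snd x < snd q") (auto simp: gap_eq)
  qed (use assms t in auto)
  moreover have "(fst x, t) \<notin> Z" using above[of "(fst x, t)"] t by auto
  ultimately show ?thesis using t by (intro exI[of _ "(fst x, t)"]) auto
qed

text \<open>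
  The sum telescopes along the piece, because \<open>prev_mark B\<close> maps the marks in its interior
  together with its end point bijectively to those in its interior together with its start.
\<close>

lemma sum_piece:
  fixes g :: "point \<Rightarrow> int"
  assumes B: "marks B" and "A \<subseteq> B" and x: "x \<in> A"
  shows "(\<Sum>m\<in>{m \<in> B - A. piece_to A m = From x}. g m - g (prev_mark B m)) =
    g (prev_mark B (next_mark A x)) - g x"
proof -
  let ?S = "{m \<in> B - A. piece_to A m = From x}"
  let ?y = "next_mark A x"
  have A: "marks A" using assms marks_subset by blast
  have fin: "finite ?S" using B by (auto simp: marks_def)
  have y: "?y \<in> A" "prev_mark A ?y = x" using A x by auto
  have sub: "prev_mark B ` insert ?y ?S \<subseteq> insert x ?S"
  proof (rule image_subsetI)
    fix m assume m: "m \<in> insert ?y ?S"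
    have mB: "m \<in> B" and px: "piece_to A m = From x"
      using m y \<open>A \<subseteq> B\<close> piece_to_mark[of ?y A] by auto
    have "piece_to A m = (if prev_mark B m \<in> A then From (prev_mark B m)
        else piece_to A (prev_mark B m))"
      using piece_to_subset[OF B \<open>A \<subseteq> B\<close>, of m] marks_bounds[OF B mB] mB by blast
    then show "prev_mark B m \<in> insert x ?S" using px mB B by (auto split: if_splits)
  qed
  have inj: "inj_on (prev_mark B) (insert ?y ?S)"
    using y \<open>A \<subseteq> B\<close> B by (intro inj_on_inverseI[of _ "next_mark B"]) auto
  have "card (prev_mark B ` insert ?y ?S) = card (insert x ?S)"
    using card_image[OF inj] fin y x by simp
  then have img: "prev_mark B ` insert ?y ?S = insert x ?S"
    using sub fin by (intro card_subset_eq) auto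
  have "(\<Sum>m\<in>insert ?y ?S. g (prev_mark B m)) = (\<Sum>m\<in>insert x ?S. g m)"
    using sum.reindex[OF inj, of g] img by simp
  then show ?thesis using fin y x by (simp add: sum_subtractf)
qed

text \<open>On a loop without marks of \<open>A\<close>, \<open>prev_mark B\<close> permutes the
  marks of \<open>B\<close>, so the two halves of the sum agree.\<close>

lemma sum_whole_loop:
  fixes g :: "point \<Rightarrow> int"
  assumes B: "marks B" and "A \<subseteq> B"
  shows "(\<Sum>m\<in>{m \<in> B - A. piece_to A m = Whole k}. g m - g (prev_mark B m)) = 0"
proof -
  let ?S = "{m \<in> B - A. piece_to A m = Whole k}"
  have fin: "finite ?S" using B by (auto simp: marks_def)
  have S: "m \<in> ?S \<longleftrightarrow> m \<in> B \<and> fst m = k \<and> k \<notin> fst ` A" for m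
    by (auto simp: piece_to_def)
  have sub: "prev_mark B ` ?S \<subseteq> ?S"
  proof (rule image_subsetI)
    fix m assume "m \<in> ?S"
    then show "prev_mark B m \<in> ?S" using B unfolding S by simp
  qed
  have inj: "inj_on (prev_mark B) ?S"
    using B by (intro inj_on_inverseI[of _ "next_mark B"]) auto
  have img: "prev_mark B ` ?S = ?S"
    using sub inj fin by (simp add: endo_inj_surj)
  have "(\<Sum>m\<in>?S. g (prev_mark B m)) = (\<Sum>m\<in>?S. g m)"
    using sum.reindex[OF inj, of g] img by simp
  then show ?thesis by (simp add: sum_subtractf)
qed

section \<open>Components of graphs\<close>

lemma equivclp_transfer:
  assumes "equivclp r x y" and "\<And>x y. r x y \<Longrightarrow> equivclp s (f x) (f y)"
  shows "equivclp s (f x) (f y)"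
  using assms(1)
proof induct
  case (step y z)
  then have "equivclp s (f y) (f z)" using assms(2) equivclp_sym by metis
  with step(3) show ?case by (rule equivclp_trans)
qed simp

lemma equivclp_mono':
  assumes "\<And>x y. r x y \<Longrightarrow> equivclp s x y"
  shows "equivclp r x y \<Longrightarrow> equivclp s x y"
  using equivclp_transfer[of r x y s "\<lambda>x. x"] assms by simp

lemma equivclp_eq_iff: "equivclp r x = equivclp r y \<longleftrightarrow> equivclp r x y"
proof
  assume "equivclp r x = equivclp r y"
  moreover have "equivclp r y y" by simp
  ultimately show "equivclp r x y" by simp
next
  assume "equivclp r x y"
  then show "equivclp r x = equivclp r y"
    by (intro ext) (blast intro: equivclp_trans equivclp_sym)
qed

text \<open>The loops of a state will be components of a graph whose vertices are the pieces.
  Classes are not intersected with \<open>P\<close>; only their representatives come from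
  it.\<close>

definition comps :: "'a set \<Rightarrow> ('a \<Rightarrow> 'a \<Rightarrow> bool) \<Rightarrow> 'a set set" where
  "comps P r = (\<lambda>x. {y. equivclp r x y}) ` P"

lemma class_eq_iff: "{y. equivclp r x y} = {y. equivclp r x' y} \<longleftrightarrow> equivclp r x x'"
  by (metis (mono_tags) Collect_cong equivclp_eq_iff mem_Collect_eq equivclp_refl equivclp_sym)

lemma card_image_eq:
  assumes "\<And>x y. x \<in> P \<Longrightarrow> y \<in> P \<Longrightarrow> f x = f y \<longleftrightarrow> g x = g y"
  shows "card (f ` P) = card (g ` P)"
proof (rule bij_betw_same_card)
  show "bij_betw (\<lambda>c. g (inv_into P f c)) (f ` P) (g ` P)"
    unfolding bij_betw_def
  proof
    show "inj_on (\<lambda>c. g (inv_into P f c)) (f ` P)"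
      by (rule inj_onI) (metis assms f_inv_into_f inv_into_into)
    have "g (inv_into P f (f x)) = g x" if "x \<in> P" for x
      using assms that by (metis f_inv_into_f image_eqI inv_into_into)
    then show "(\<lambda>c. g (inv_into P f c)) ` f ` P = g ` P"
      by (auto simp: image_image image_iff)
  qed
qed

lemma card_comps_image:
  assumes "\<And>x y. x \<in> P \<Longrightarrow> y \<in> P \<Longrightarrow> equivclp r x y \<longleftrightarrow> equivclp r' (f x) (f y)"
  shows "card (comps P r) = card (comps (f ` P) r')"
  unfolding comps_def image_image by (rule card_image_eq) (simp add: class_eq_iff assms)

text \<open>A contraction of graphs: edges map to paths, every edge lifts, and fibres are connected.
  So components correspond.\<close>

lemma card_comps_contract:
  assumes "\<And>a b. r a b \<Longrightarrow> equivclp r' (f a) (f b)"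
    and "\<And>a' b'. r' a' b' \<Longrightarrow> \<exists>a\<in>P. \<exists>b\<in>P. f a = a' \<and> f b = b' \<and> equivclp r a b"
    and "\<And>a b. a \<in> P \<Longrightarrow> b \<in> P \<Longrightarrow> f a = f b \<Longrightarrow> equivclp r a b"
  shows "card (comps (f ` P) r') = card (comps P r)"
proof (rule card_comps_image[symmetric])
  fix x y assume xy: "x \<in> P" "y \<in> P"
  \<comment> \<open>The claim covers all preimages \<open>b\<close>, since consecutive lifted edges
    may meet a fibre in different points; connectedness of the fibre bridges them.\<close>
  have "\<forall>b\<in>P. f b = z \<longrightarrow> equivclp r x b" if "equivclp r' (f x) z" for z
    using that
  proof induct
    case base
    then show ?case using assms(3) xy by metis
  next
    case (step y z)
    obtain a b where "a \<in> P" "b \<in> P" "f a = y" "f b = z" "equivclp r a b"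
      using step(2) assms(2) equivclp_sym by metis
    then show ?case using step(3) assms(3) by (metis equivclp_trans)
  qed
  then show "equivclp r x y \<longleftrightarrow> equivclp r' (f x) (f y)"
    using equivclp_transfer[of r x y r' f] assms(1) xy by blast
qed

definition add_edge :: "'a \<Rightarrow> 'a \<Rightarrow> ('a \<Rightarrow> 'a \<Rightarrow> bool) \<Rightarrow> 'a \<Rightarrow> 'a \<Rightarrow> bool" where
  "add_edge u v r x y \<longleftrightarrow> r x y \<or> x = u \<and> y = v"

lemma equivclp_add_edge_redundant:
  assumes "equivclp r u v"
  shows "equivclp (add_edge u v r) = equivclp r"
proof (intro ext iffI)
  show "equivclp r x y" if "equivclp (add_edge u v r) x y" for x y
    using that by (rule equivclp_mono'[rotated]) (auto simp: add_edge_def assms)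
  show "equivclp (add_edge u v r) x y" if "equivclp r x y" for x y
    using that by (rule equivclp_mono'[rotated]) (auto simp: add_edge_def)
qed

lemma equivclp_add_edge:
  "equivclp (add_edge u v r) x y \<longleftrightarrow> equivclp r x y \<or>
     (equivclp r x u \<or> equivclp r x v) \<and> (equivclp r y u \<or> equivclp r y v)" (is "?L \<longleftrightarrow> ?R")
proof
  show "?R" if "?L"
    using that
  proof induct
    case (step y z)
    then show ?case by (auto simp: add_edge_def dest: equivclp_sym intro: equivclp_trans)
  qed simp
next
  have *: "equivclp (add_edge u v r) x y" if "equivclp r x y" for x y
    using that by (rule equivclp_mono'[rotated]) (auto simp: add_edge_def)
  have "equivclp (add_edge u v r) u v" by (auto simp: add_edge_def)
  then show "?R \<Longrightarrow> ?L" by (metis * equivclp_sym equivclp_trans)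
qed

text \<open>The classes of \<open>u\<close> and \<open>v\<close> merge into one, and the classes in
  \<open>?rest\<close> stay as they are.\<close>

lemma card_comps_add_edge:
  assumes "finite P" "u \<in> P" "v \<in> P" "\<not> equivclp r u v"
  shows "card (comps P r) = Suc (card (comps P (add_edge u v r)))"
proof -
  let ?c = "\<lambda>x. {y. equivclp r x y}"
  let ?rest = "?c ` {x \<in> P. \<not> equivclp r x u \<and> \<not> equivclp r x v}"
  have new: "{y. equivclp (add_edge u v r) x y} =
      (if equivclp r x u \<or> equivclp r x v then ?c u \<union> ?c v else ?c x)" for x
    unfolding equivclp_add_edge by (auto dest: equivclp_sym intro: equivclp_trans)
  have "P = {x \<in> P. \<not> equivclp r x u \<and> \<not> equivclp r x v} \<union>
      {x \<in> P. equivclp r x u \<or> equivclp r x v}" by auto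
  then have "comps P (add_edge u v r) =
      ?rest \<union> (\<lambda>x. ?c u \<union> ?c v) ` {x \<in> P. equivclp r x u \<or> equivclp r x v}"
    unfolding comps_def new by auto
  also have "\<dots> = insert (?c u \<union> ?c v) ?rest"
    using assms(2) by auto
  finally have "comps P (add_edge u v r) = insert (?c u \<union> ?c v) ?rest" .
  moreover have "comps P r = insert (?c u) (insert (?c v) ?rest)"
  proof -
    have "?c ` {x \<in> P. equivclp r x w} = {?c w}" if "w \<in> P" for w
    proof -
      have "?c x = ?c w" if "equivclp r x w" for x using that by (simp add: class_eq_iff)
      moreover have "w \<in> {x \<in> P. equivclp r x w}" using that by simp
      ultimately show ?thesis by blast
    qed
    note eq = this[OF assms(2)] this[OF assms(3)]
    have "P = {x \<in> P. equivclp r x u} \<union> ({x \<in> P. equivclp r x v} \<union>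
        {x \<in> P. \<not> equivclp r x u \<and> \<not> equivclp r x v})" by auto
    then have "?c ` P = ?c ` {x \<in> P. equivclp r x u} \<union> (?c ` {x \<in> P. equivclp r x v} \<union> ?rest)"
      by (simp only: image_Un[symmetric])
    then show ?thesis unfolding comps_def eq by (simp only: Un_insert_left Un_empty_left)
  qed
  moreover have "?c u \<union> ?c v \<notin> ?rest"
  proof
    assume "?c u \<union> ?c v \<in> ?rest"
    then obtain x where "\<not> equivclp r x u" "?c u \<union> ?c v = ?c x" by auto
    moreover have "u \<in> ?c u \<union> ?c v" by simp
    ultimately show False by (metis mem_Collect_eq)
  qed
  moreover have "?c w \<notin> ?rest" if "w = u \<or> w = v" for w
  proof
    assume "?c w \<in> ?rest"
    then obtain x where "\<not> equivclp r x u" "\<not> equivclp r x v" "?c w = ?c x" by blast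
    then have "\<not> equivclp r x w" "equivclp r w x" using that class_eq_iff[of r] by auto
    then show False using equivclp_sym by metis
  qed
  then have "?c u \<notin> ?rest" "?c v \<notin> ?rest" by blast+
  moreover have "?c u \<noteq> ?c v"
    using assms(4) class_eq_iff[of r] by simp
  moreover have "finite ?rest" using assms(1) by auto
  ultimately show ?thesis by simp
qed

section \<open>Removing two edges from a permutation\<close>

text \<open>Extended by the identity outside \<open>S\<close>, \<open>P\<close> is a permutation of
  finite order on \<open>x\<close>. The formulation relative to \<open>S\<close> fits the travelling
  map, whose injectivity is shown only on the directed pieces that occur.\<close>

lemma funpow_return:
  assumes "finite S" "inj_on P S" "P ` S \<subseteq> S" "x \<in> S"
  shows "\<exists>n>0. (P ^^ n) x = x"
proof -
  define g where "g x = (if x \<in> S then P x else x)" for x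
  have "P ` S = S" using assms by (simp add: endo_inj_surj)
  then have "bij_betw g S S"
    using assms(2) by (auto simp: bij_betw_def g_def inj_on_def)
  then have "g permutes S" by (rule bij_imp_permutes) (simp add: g_def)
  then have "permutation g" using assms(1) permutation_permutes by blast
  then obtain n where n: "0 < n" "(g ^^ n) x = x" using permutation_self by metis
  have "(g ^^ m) x = (P ^^ m) x \<and> (P ^^ m) x \<in> S" for m
    using assms by (induct m) (auto simp: g_def)
  then show ?thesis using n by metis
qed

text \<open>
  Cutting a permutation open after \<open>u\<close> and \<open>v\<close> leaves two paths, which start at \<open>P u\<close> and
  \<open>P v\<close> and end at \<open>u\<close> and \<open>v\<close> in some order.
\<close>

lemma cut_permutation:
  assumes fin: "finite S" and inj: "inj_on P S" and PS: "P ` S \<subseteq> S"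
    and uv: "u \<in> S" "v \<in> S" "u \<noteq> v"
  defines "r \<equiv> \<lambda>s s'. s \<in> S - {u, v} \<and> s' = P s"
  shows "(equivclp r (P u) u \<and> equivclp r (P v) v \<or> equivclp r (P u) v \<and> equivclp r (P v) u) \<and>
    \<not> equivclp r u v"
proof -
  have S_pow: "(P ^^ n) x \<in> S" if "x \<in> S" for x n
    using that PS by (induct n) auto
  \<comment> \<open>The iterates from \<open>P w\<close> come back to \<open>w\<close>, so there is
    a first one in \<open>{u, v}\<close>: the end of the path.\<close>
  have reach: "\<exists>n. (P ^^ n) (P w) \<in> {u, v} \<and> (\<forall>j<n. (P ^^ j) (P w) \<notin> {u, v})"
    if "w \<in> {u, v}" for w
  proof -
    have "w \<in> S" using that uv by auto
    then obtain k where "0 < k" "(P ^^ k) w = w"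
      using funpow_return[OF fin inj PS] by metis
    then have "(P ^^ (k - 1)) (P w) = w"
      by (metis Suc_diff_1 comp_apply funpow_Suc_right)
    then have "\<exists>n. (P ^^ n) (P w) \<in> {u, v}" using that by metis
    then show ?thesis by (rule exists_least_iff[THEN iffD1])
  qed
  have path: "equivclp r x ((P ^^ n) x)" if "x \<in> S" "\<forall>j<n. (P ^^ j) x \<notin> {u, v}" for x n
    using that(2)
  proof (induct n)
    case (Suc n)
    then have "r ((P ^^ n) x) ((P ^^ Suc n) x)" using S_pow[OF that(1)] by (auto simp: r_def)
    then show ?case using Suc by (meson equivclp_into_equivclp less_SucI)
  qed simp
  have Pu: "P u \<in> S" "P v \<in> S" using PS uv by auto
  obtain n where n: "(P ^^ n) (P u) \<in> {u, v}" "\<forall>j<n. (P ^^ j) (P u) \<notin> {u, v}"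
    using reach[of u] by blast
  obtain m where m: "(P ^^ m) (P v) \<in> {u, v}" "\<forall>j<m. (P ^^ j) (P v) \<notin> {u, v}"
    using reach[of v] by blast
  \<comment> \<open>The path from \<open>P u\<close> to its first hit of \<open>{u, v}\<close>. No
    edge of \<open>r\<close> enters or leaves it, so it is a union of classes, and its end is its
    only member of \<open>{u, v}\<close>. This separates the two paths.\<close>
  define W where "W = (\<lambda>j. (P ^^ j) (P u)) ` {..n}"
  have W_S: "W \<subseteq> S" using S_pow[OF Pu(1)] by (auto simp: W_def)
  have closed: "s \<in> W \<longleftrightarrow> s' \<in> W" if "r s s'" for s s'
  proof
    assume "s \<in> W"
    then obtain j where j: "j \<le> n" "s = (P ^^ j) (P u)" by (auto simp: W_def)
    then have "j \<noteq> n" using that n by (auto simp: r_def)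
    then show "s' \<in> W" using j that unfolding W_def r_def by (intro image_eqI[of _ _ "Suc j"]) auto
  next
    assume "s' \<in> W"
    then obtain j where j: "j \<le> n" "s' = (P ^^ j) (P u)" by (auto simp: W_def)
    have s: "s \<in> S" "s \<noteq> u" "s' = P s" using that by (auto simp: r_def)
    have "j \<noteq> 0"
    proof
      assume "j = 0"
      then have "P s = P u" using j s by simp
      then show False using inj_onD[OF inj] s uv by blast
    qed
    then obtain i where i: "j = Suc i" by (cases j) auto
    then have "P s = P ((P ^^ i) (P u))" using j s by simp
    then have "s = (P ^^ i) (P u)" using inj_onD[OF inj] s S_pow[OF Pu(1)] by blast
    then show "s \<in> W" using i j by (auto simp: W_def)
  qed
  have W_class: "x \<in> W \<longleftrightarrow> y \<in> W" if "equivclp r x y" for x y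
    using that by induct (use closed in blast)+
  define e where "e = (P ^^ n) (P u)"
  have eW: "e \<in> W" "P u \<in> W" by (auto simp: W_def e_def intro!: image_eqI[of "P u" _ 0])
  have e_only: "x = e" if "x \<in> W" "x \<in> {u, v}" for x
    using that n by (auto simp: W_def e_def le_less)
  \<comment> \<open>Otherwise \<open>P v\<close> is either the start \<open>P u\<close>, against
    injectivity, or preceded on the path by \<open>v\<close>, which would end the path too
    early.\<close>
  have "P v \<notin> W"
  proof
    assume "P v \<in> W"
    then obtain j where j: "j \<le> n" "P v = (P ^^ j) (P u)" by (auto simp: W_def)
    have "j \<noteq> 0"
    proof
      assume "j = 0"
      then have "P v = P u" using j by simp
      then show False using inj_onD[OF inj] uv by blast
    qed
    then obtain i where i: "j = Suc i" by (cases j) auto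
    then have "v = (P ^^ i) (P u)"
      using j uv inj_onD[OF inj, of v "(P ^^ i) (P u)"] S_pow[OF Pu(1)] by auto
    moreover have "i < n" using i j(1) by simp
    ultimately show False using n(2) by blast
  qed
  moreover have "equivclp r (P u) e" using path[OF Pu(1) n(2)] by (simp add: e_def)
  moreover have e2: "equivclp r (P v) ((P ^^ m) (P v))" using path[OF Pu(2) m(2)] .
  ultimately have "(P ^^ m) (P v) \<noteq> e" using eW W_class by metis
  moreover have "e \<in> {u, v}" using n(1) by (simp add: e_def)
  moreover have "\<not> equivclp r u v"
    using e_only W_class[of u v] eW(1) \<open>e \<in> {u, v}\<close> uv(3) by blast
  ultimately show ?thesis
    using e2 m(1) \<open>equivclp r (P u) e\<close> by auto
qed

section \<open>Travelling along marked loops\<close>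

text \<open>
  The traversal of a state, for an arbitrary set \<open>M\<close> of marks, each of which is joined to a mark
  \<open>opp x\<close> by an orientation-respecting (\<open>ori x\<close>) or orientation-reversing smoothing.  A mark with
  \<open>opp x = x\<close> and \<open>ori x\<close> is simply passed through, as a virtual crossing is.
\<close>

fun trav :: "point set \<Rightarrow> (point \<Rightarrow> point) \<Rightarrow> (point \<Rightarrow> bool) \<Rightarrow> piece \<times> bool \<Rightarrow> piece \<times> bool" where
  "trav M opp ori (Whole k, along) = (Whole k, along)"
| "trav M opp ori (From p, along) =
     (let x = (if along then next_mark M p else p);
          y = opp x;
          along' = (if ori x then along else \<not> along)
      in if along' then (From y, True) else (piece_to M y, False))"

definition pieces_of :: "nat \<Rightarrow> point set \<Rightarrow> piece set" where
  "pieces_of n M = {Whole k | k. k < n \<and> k \<notin> fst ` M} \<union> From ` M"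

definition rev_dir :: "piece \<times> bool \<Rightarrow> piece \<times> bool" where
  "rev_dir z = (fst z, \<not> snd z)"

lemma rev_dir_simps [simp]:
  "rev_dir (s, b) = (s, \<not> b)" "fst (rev_dir z) = fst z" "rev_dir (rev_dir z) = z"
  by (simp_all add: rev_dir_def)

text \<open>The set \<open>X\<close> of marks that contribute edges is separate from the set
  \<open>M\<close> that cuts the loops, so that a crossing can be cut open. At an oriented mark one
  form suffices: it is read forwards for travel along the orientation and backwards for travel
  against it.\<close>

definition djoin :: "point set \<Rightarrow> (point \<Rightarrow> point) \<Rightarrow> (point \<Rightarrow> bool) \<Rightarrow> point set
    \<Rightarrow> piece \<times> bool \<Rightarrow> piece \<times> bool \<Rightarrow> bool" where
  "djoin M opp ori X z w \<longleftrightarrow> (\<exists>x\<in>X.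
     if ori x then fst z = piece_to M x \<and> fst w = From (opp x) \<and> snd w = snd z
     else (fst z = piece_to M x \<and> fst w = piece_to M (opp x) \<or>
           fst z = From x \<and> fst w = From (opp x)) \<and> snd w = (\<not> snd z))"

definition join :: "point set \<Rightarrow> (point \<Rightarrow> point) \<Rightarrow> (point \<Rightarrow> bool) \<Rightarrow> point set
    \<Rightarrow> piece \<Rightarrow> piece \<Rightarrow> bool" where
  "join M opp ori X s t \<longleftrightarrow> (\<exists>x\<in>X.
     if ori x then s = piece_to M x \<and> t = From (opp x)
     else s = piece_to M x \<and> t = piece_to M (opp x) \<or> s = From x \<and> t = From (opp x))"

lemma directed_cases:
  obtains (Whole) k b where "z = (Whole k, b)" | (From) p b where "z = (From p, b)"
  by (metis piece.exhaust surj_pair)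

lemma djoin_join: "djoin M opp ori X z w \<Longrightarrow> join M opp ori X (fst z) (fst w)"
  unfolding djoin_def join_def by (auto split: if_splits)

lemma join_djoin: "join M opp ori X s t \<Longrightarrow> \<exists>b'. djoin M opp ori X (s, b) (t, b')"
  unfolding djoin_def join_def by (auto split: if_splits)

lemma djoin_rev: "djoin M opp ori X z w \<Longrightarrow> djoin M opp ori X (rev_dir z) (rev_dir w)"
  unfolding djoin_def rev_dir_def by (auto split: if_splits)

text \<open>The condition \<open>ori_fixed\<close> excludes a reversal at a mark fixed by
  \<open>opp\<close>: travel would turn back on the same piece, and a loop could contain a piece in
  both directions.\<close>

locale marked_loops =
  fixes n :: nat and M :: "point set" and opp :: "point \<Rightarrow> point" and ori :: "point \<Rightarrow> bool"
  assumes marks: "marks M"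
    and fst_less: "fst ` M \<subseteq> {..<n}"
    and opp_in [simp]: "x \<in> M \<Longrightarrow> opp x \<in> M"
    and opp_opp [simp]: "x \<in> M \<Longrightarrow> opp (opp x) = x"
    and ori_opp [simp]: "x \<in> M \<Longrightarrow> ori (opp x) = ori x"
    and ori_fixed: "x \<in> M \<Longrightarrow> opp x = x \<Longrightarrow> ori x"
begin

abbreviation "T \<equiv> trav M opp ori"
abbreviation "S \<equiv> pieces_of n M"

declare marks [simp]

lemma finite_pieces: "finite S"
  using marks_finite[OF marks] by (auto simp: pieces_of_def)

lemma piece_to_in [simp]: "x \<in> M \<Longrightarrow> piece_to M x = From (prev_mark M x)"
  by (rule piece_to_mark)

lemma From_in [simp]: "From x \<in> S \<longleftrightarrow> x \<in> M"
  by (auto simp: pieces_of_def)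

lemma trav_in: "fst z \<in> S \<Longrightarrow> fst (T z) \<in> S"
  by (cases z rule: directed_cases) (auto simp: Let_def)

text \<open>Reversal of direction conjugates the traversal to its inverse, which gives injectivity
  at once.\<close>

lemma trav_rev: "fst z \<in> S \<Longrightarrow> T (rev_dir (T z)) = rev_dir z"
  by (cases z rule: directed_cases) (auto simp: Let_def)

lemma trav_inj: "inj_on T {z. fst z \<in> S}"
  by (rule inj_onI) (metis (mono_tags) trav_rev mem_Collect_eq rev_dir_simps(3))

lemma finite_directed: "finite {z :: piece \<times> bool. fst z \<in> S}"
proof -
  have "{z :: piece \<times> bool. fst z \<in> S} = S \<times> (UNIV :: bool set)" by auto
  then show ?thesis using finite_cartesian_product[OF finite_pieces, of "UNIV :: bool set"] by simp
qed

text \<open>Since \<open>orbit\<close> starts at \<open>T z\<close> rather than at \<open>z\<close>,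
  membership of \<open>z\<close> needs the return along a finite cycle.\<close>

lemma self_in_orbit:
  assumes "fst z \<in> S"
  shows "z \<in> orbit T z"
proof -
  have "T ` {z. fst z \<in> S} \<subseteq> {z. fst z \<in> S}" using trav_in by blast
  then obtain k where "k > 0" "(T ^^ k) z = z"
    using funpow_return[OF finite_directed trav_inj] assms by blast
  then show ?thesis unfolding orbit_altdef by force
qed

lemma orbit_in: "w \<in> orbit T z \<Longrightarrow> fst z \<in> S \<Longrightarrow> fst w \<in> S"
  by (induct rule: orbit.induct) (auto intro: trav_in)

lemma djoin_trav: "fst z \<in> S \<Longrightarrow> equivclp (djoin M opp ori M) z (T z)"
proof (cases z rule: directed_cases)
  case 2: (From p along)
  assume "fst z \<in> S"
  then have "From p \<in> S" using 2 by simp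
  then have p: "p \<in> M" unfolding From_in .
  have d: "djoin M opp ori M z (T z) \<or> djoin M opp ori M (T z) z"
  proof (cases along)
    case True
    then show ?thesis using 2 p unfolding djoin_def
      by (intro disjI1 bexI[of _ "next_mark M p"]) (auto simp: Let_def)
  next
    case False
    show ?thesis
    proof (cases "ori p")
      case True
      then show ?thesis using 2 p \<open>\<not> along\<close> unfolding djoin_def
        by (intro disjI2 bexI[of _ "opp p"]) (auto simp: Let_def)
    next
      case F: False
      then show ?thesis using 2 p \<open>\<not> along\<close> unfolding djoin_def
        by (intro disjI1 bexI[of _ p]) (auto simp: Let_def)
    qed
  qed
  then show ?thesis by auto
qed simp

lemma trav_djoin:
  assumes "djoin M opp ori M z w"
  shows "T z = w \<and> fst z \<in> S \<or> T w = z \<and> fst w \<in> S"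
proof -
  obtain x where x: "x \<in> M" "if ori x then fst z = piece_to M x \<and> fst w = From (opp x) \<and> snd w = snd z
     else (fst z = piece_to M x \<and> fst w = piece_to M (opp x) \<or>
           fst z = From x \<and> fst w = From (opp x)) \<and> snd w = (\<not> snd z)"
    using assms unfolding djoin_def by auto
  then show ?thesis
    by (cases z; cases w; cases "snd z") (auto simp: Let_def split: if_splits)
qed

text \<open>Orbits are finite cycles, so a backward step can be replaced by going forward all the
  way round. Forward reachability thus becomes connectedness in an undirected graph.\<close>

lemma orbit_trav: "fst z \<in> S \<Longrightarrow> orbit T z = {w. equivclp (djoin M opp ori M) z w}"
proof (intro set_eqI iffI; simp)
  fix w assume z: "fst z \<in> S"
  show "equivclp (djoin M opp ori M) z w" if "w \<in> orbit T z"
    using that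
  proof induct
    case (step y)
    then show ?case using djoin_trav[OF orbit_in[OF step(1) z]] by (metis equivclp_trans)
  qed (rule djoin_trav[OF z])
  show "w \<in> orbit T z" if "equivclp (djoin M opp ori M) z w"
    using that
  proof induct
    case base
    then show ?case using self_in_orbit z .
  next
    case (step y w)
    then have "T y = w \<and> fst y \<in> S \<or> T w = y \<and> fst w \<in> S" using trav_djoin by blast
    then show ?case
    proof
      assume "T y = w \<and> fst y \<in> S"
      then show ?thesis using step(3) by (metis orbit.step)
    next
      assume w: "T w = y \<and> fst w \<in> S"
      then have "w \<in> orbit T y" using self_in_orbit[of w] self_in_orbit_step[of w T] by metis
      then show ?thesis using step(3) orbit_trans by metis
    qed
  qed
qed

lemma fst_orbit_trav:
  assumes "s \<in> S"
  shows "fst ` orbit T (s, b) = {t. equivclp (join M opp ori M) s t}"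
proof (intro set_eqI iffI)
  fix t assume "t \<in> fst ` orbit T (s, b)"
  then obtain w where w: "equivclp (djoin M opp ori M) (s, b) w" "t = fst w"
    using assms orbit_trav[of "(s, b)"] by auto
  have "equivclp (join M opp ori M) (fst (s, b)) (fst w)"
    using w(1) by (rule equivclp_transfer) (rule r_into_equivclp, rule djoin_join)
  then show "t \<in> {t. equivclp (join M opp ori M) s t}" using w by simp
next
  fix t assume "t \<in> {t. equivclp (join M opp ori M) s t}"
  then have "equivclp (join M opp ori M) s t" by simp
  then have "\<exists>b'. equivclp (djoin M opp ori M) (s, b) (t, b')"
  proof induct
    case (step y t)
    then obtain c where c: "equivclp (djoin M opp ori M) (s, b) (y, c)" by auto
    have "\<exists>c'. equivclp (djoin M opp ori M) (y, c) (t, c')"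
      using step(2)
    proof
      assume "join M opp ori M y t"
      then show ?thesis using join_djoin by blast
    next
      assume "join M opp ori M t y"
      \<comment> \<open>The lift has a prescribed direction at \<open>t\<close>, while it is needed
        at \<open>y\<close>; if it comes out wrong there, both ends are reversed.\<close>
      then obtain c' where "djoin M opp ori M (t, c) (y, c')" using join_djoin by blast
      moreover from djoin_rev[OF this] have "djoin M opp ori M (t, \<not> c) (y, \<not> c')" by simp
      ultimately show ?thesis by (cases "c = c'") auto
    qed
    then show ?case using c equivclp_trans by metis
  next
    case base
    show ?case by (rule exI[of _ b]) simp
  qed
  then show "t \<in> fst ` orbit T (s, b)"
    using assms orbit_trav[of "(s, b)"] by force
qed

text \<open>By reversal symmetry, a path from \<open>z\<close> to its reverse loses one step at each
  end and becomes a path from \<open>T z\<close> to its reverse. The descent ends with a directed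
  piece equal to its own reverse, or with one that turns back on itself, and both are
  impossible.\<close>

lemma rev_notin_orbit:
  assumes "fst z \<in> S"
  shows "rev_dir z \<notin> orbit T z"
proof -
  have "(T ^^ k) z \<noteq> rev_dir z" if "fst z \<in> S" for k z
    using that
  proof (induct k arbitrary: z rule: less_induct)
    case (less k)
    consider "k = 0" | "k = 1" | j where "k = Suc (Suc j)"
      by (metis One_nat_def old.nat.exhaust)
    then show ?case
    proof cases
      case 1
      then show ?thesis by (simp add: rev_dir_def prod_eq_iff)
    next
      case 2
      have "T z \<noteq> rev_dir z"
      proof (cases z rule: directed_cases)
        case 2: (From p along)
        then have "From p \<in> S" using less(2) by simp
        then have p: "p \<in> M" unfolding From_in .
        show ?thesis
        proof (cases along)
          case True
          \<comment> \<open>Turning back onto the same piece forces its end mark to be fixed by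
            \<open>opp\<close>.\<close>
          have "next_mark M p = opp (next_mark M p)"
            if "\<not> ori (next_mark M p)" "prev_mark M (opp (next_mark M p)) = p"
            using that p by (metis marks next_mark_in next_prev_mark opp_in)
          then show ?thesis using 2 p True ori_fixed[of "next_mark M p"] by (auto simp: Let_def)
        next
          case False
          then show ?thesis using 2 p ori_fixed[of p] by (auto simp: Let_def)
        qed
      qed auto
      then show ?thesis using 2 by simp
    next
      case (3 j)
      show ?thesis
      proof
        assume "(T ^^ k) z = rev_dir z"
        then have e: "T ((T ^^ j) (T z)) = rev_dir z" using 3 by (simp add: funpow_swap1)
        have "fst ((T ^^ j) (T z)) \<in> S"
          using less(2) by (induct j) (auto intro: trav_in)
        moreover have "T (rev_dir (T z)) = rev_dir z" using trav_rev less(2) .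
        ultimately have "(T ^^ j) (T z) = rev_dir (T z)"
          using e trav_in[OF less(2)] inj_onD[OF trav_inj, of "(T ^^ j) (T z)" "rev_dir (T z)"]
          by (metis mem_Collect_eq rev_dir_simps(2))
        then show False using less(1)[of j "T z"] 3 trav_in[OF less(2)] by auto
      qed
    qed
  qed
  from this[OF assms] show ?thesis unfolding orbit_altdef by fastforce
qed

end

section \<open>The three ways of joining the marks of a crossing\<close>

lemma djoin_cong:
  assumes "\<And>x. x \<in> X \<Longrightarrow> opp x = opp' x \<and> ori x = ori' x"
  shows "djoin M opp ori X = djoin M opp' ori' X"
  unfolding djoin_def fun_eq_iff using assms by (auto split: if_splits)

lemma join_cong:
  assumes "\<And>x. x \<in> X \<Longrightarrow> opp x = opp' x \<and> ori x = ori' x"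
  shows "join M opp ori X = join M opp' ori' X"
  unfolding join_def fun_eq_iff using assms by (auto split: if_splits)

lemma djoin_mono: "djoin M opp ori X z w \<Longrightarrow> X \<subseteq> Y \<Longrightarrow> djoin M opp ori Y z w"
  unfolding djoin_def by blast

text \<open>
  A colouring as below (Alexander numberings modulo 2 yield one) orients the pieces in such a way
  that every smoothing of every crossing respects the orientations: a piece of colour \<open>True\<close> is
  given the orientation of the loop, and the others the opposite one.
\<close>

locale coloured_loops = marked_loops +
  fixes col :: "piece \<Rightarrow> bool"
  assumes col_pass: "x \<in> M \<Longrightarrow> col (From x) \<longleftrightarrow> \<not> col (piece_to M x)"
    and col_opp: "x \<in> M \<Longrightarrow> col (From (opp x)) \<longleftrightarrow> col (piece_to M x)"
begin

lemma col_opp': "x \<in> M \<Longrightarrow> col (piece_to M (opp x)) \<longleftrightarrow> \<not> col (piece_to M x)"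
  using col_pass[of "opp x"] col_opp[of x] by (simp del: piece_to_in)

text \<open>Travel with the source-sink orientation stays with it across every join, and travel
  against it stays against it.\<close>

lemma djoin_col:
  assumes "X \<subseteq> M" "djoin M opp ori X z w"
  shows "snd z = col (fst z) \<longleftrightarrow> snd w = col (fst w)"
proof -
  obtain x where x: "x \<in> M" "if ori x then fst z = piece_to M x \<and> fst w = From (opp x) \<and> snd w = snd z
     else (fst z = piece_to M x \<and> fst w = piece_to M (opp x) \<or>
           fst z = From x \<and> fst w = From (opp x)) \<and> snd w = (\<not> snd z)"
    using assms unfolding djoin_def by auto
  then show ?thesis
    using col_opp[OF x(1)] col_opp'[OF x(1)] col_pass[OF x(1)]
    by (auto simp del: piece_to_in split: if_splits)
qed

text \<open>Colours turn an undirected path into a directed one: the direction at each end is read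
  off the colour there.\<close>

lemma equivclp_join_djoin:
  assumes "X \<subseteq> M" "equivclp (join M opp ori X) s t"
  shows "equivclp (djoin M opp ori X) (s, col s = b) (t, col t = b)"
proof -
  have "djoin M opp ori X (s, col s = b) (t, col t = b)" if "join M opp ori X s t" for s t
  proof -
    obtain b' where b': "djoin M opp ori X (s, col s = b) (t, b')"
      using join_djoin \<open>join M opp ori X s t\<close> by blast
    from djoin_col[OF assms(1) this] have "b' = (col t = b)" by auto
    then show ?thesis using b' by simp
  qed
  then show ?thesis
    using equivclp_transfer[OF assms(2), of "djoin M opp ori X" "\<lambda>s. (s, col s = b)"] by blast
qed

lemma cut_crossing_aux:
  assumes p: "p \<in> M" "opp p \<noteq> p" "ori p" and col: "col (piece_to M p)"
  defines "q \<equiv> opp p"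
  defines "R \<equiv> equivclp (join M opp ori (M - {p, q}))"
  shows "(R (From q) (piece_to M p) \<and> R (piece_to M q) (From p) \<or>
      R (From q) (From p) \<and> R (piece_to M q) (piece_to M p)) \<and> \<not> R (piece_to M p) (From p)"
proof -
  \<comment> \<open>Traversal in the direction given by the colours. It permutes the pieces, enters
    the crossing by \<open>piece_to M p\<close> and \<open>From p\<close>, and leaves it by
    \<open>From q\<close> and \<open>piece_to M q\<close>. The permutation is cut open after the two
    entering pieces.\<close>
  define P where "P s = fst (T (s, col s))" for s
  define r where "r = (\<lambda>s t. s \<in> S - {piece_to M p, From p} \<and> t = P s)"
  have q: "q \<in> M" "opp q = p" "ori q" "q \<noteq> p" using p by (auto simp: q_def)
  have cols: "\<not> col (From p)" "col (From q)" "\<not> col (piece_to M q)"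
    using col_pass[OF p(1)] col_opp[OF p(1)] col_pass[OF q(1)] col
    by (simp_all add: q_def[symmetric] del: piece_to_in)
  have col_T: "T (s, col s) = (P s, col (P s))" if "s \<in> S" for s
  proof -
    have "snd z = col (fst z) \<longleftrightarrow> snd w = col (fst w)" if "equivclp (djoin M opp ori M) z w" for z w
      using that by induct (use djoin_col[OF subset_refl] in blast)+
    from this[OF djoin_trav, of "(s, col s)"] that have "snd (T (s, col s)) = col (P s)"
      by (simp add: P_def)
    then show ?thesis by (simp add: P_def prod_eq_iff)
  qed
  have "(equivclp r (P (piece_to M p)) (piece_to M p) \<and> equivclp r (P (From p)) (From p) \<or>
      equivclp r (P (piece_to M p)) (From p) \<and> equivclp r (P (From p)) (piece_to M p)) \<and>
      \<not> equivclp r (piece_to M p) (From p)"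
    unfolding r_def
  proof (rule cut_permutation)
    show "inj_on P S"
    proof (rule inj_onI)
      fix s t assume st: "s \<in> S" "t \<in> S" "P s = P t"
      then have "T (s, col s) = T (t, col t)" using col_T by simp
      then show "s = t" using inj_onD[OF trav_inj, of "(s, col s)" "(t, col t)"] st by simp
    qed
    show "P ` S \<subseteq> S" using trav_in by (auto simp: P_def)
    show "piece_to M p \<noteq> From p" using cols col by metis
  qed (use p finite_pieces in auto)
  moreover have "P (piece_to M p) = From q" "P (From p) = piece_to M q"
    using col cols p by (auto simp: P_def q_def Let_def)
  \<comment> \<open>Dropping the two steps of \<open>P\<close> through the crossing drops exactly
    the joins at \<open>p\<close> and \<open>q\<close>.\<close>
  moreover have "equivclp r = R"
  proof (intro ext iffI)
    fix s t assume "equivclp r s t"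
    then show "R s t" unfolding R_def
    proof (rule equivclp_mono'[rotated])
      fix s t assume r: "r s t"
      show "equivclp (join M opp ori (M - {p, q})) s t"
      proof (cases s)
        case (Whole k)
        then show ?thesis using r by (simp add: r_def P_def)
      next
        case (From y)
        have s: "From y \<in> S" "s \<noteq> piece_to M p" "s \<noteq> From p" "t = P s"
          using r From by (auto simp: r_def)
        then have y: "y \<in> M" unfolding From_in by blast
        show ?thesis
        proof (cases "col s")
          case True
          have "s = piece_to M (next_mark M y)" using From y by simp
          moreover from this have "next_mark M y \<in> M - {p, q}" using s True cols y by auto
          ultimately have "join M opp ori (M - {p, q}) s t"
            unfolding join_def using s y True From
            by (intro bexI[of _ "next_mark M y"]) (auto simp: P_def Let_def)
          then show ?thesis by auto
        next
          case False
          have X: "y \<in> M - {p, q}" using s False cols y From by auto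
          then have X': "opp y \<in> M - {p, q}" using p q by (auto simp: q_def) (metis opp_opp)+
          show ?thesis
          proof (cases "ori y")
            case True
            then have "join M opp ori (M - {p, q}) t s"
              unfolding join_def using s y False From X'
              by (intro bexI[of _ "opp y"]) (auto simp: P_def Let_def)
            then show ?thesis by auto
          next
            case F: False
            then have "join M opp ori (M - {p, q}) s t"
              unfolding join_def using s y False From X
              by (intro bexI[of _ "y"]) (auto simp: P_def Let_def)
            then show ?thesis by auto
          qed
        qed
      qed
    qed
  next
    fix s t assume "R s t"
    then show "equivclp r s t" unfolding R_def
    proof (rule equivclp_mono'[rotated])
      fix s t assume "join M opp ori (M - {p, q}) s t"
      then obtain x where x: "x \<in> M" "x \<noteq> p" "x \<noteq> q"
        and st: "if ori x then s = piece_to M x \<and> t = From (opp x)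
          else s = piece_to M x \<and> t = piece_to M (opp x) \<or> s = From x \<and> t = From (opp x)"
        unfolding join_def by blast
      have opp_x: "opp x \<noteq> p" "opp x \<noteq> q" using x q p by (metis opp_opp)+
      have prev: "prev_mark M x \<noteq> prev_mark M p" "prev_mark M (opp x) \<noteq> prev_mark M p"
        using x opp_x p by (metis marks next_prev_mark opp_in)+
      note c = col_opp[OF x(1)] col_opp'[OF x(1)] col_pass[OF x(1)]
      have "r s t \<or> r t s"
        using st x opp_x prev c cols col p
        by (cases "col s") (auto simp: r_def P_def Let_def split: if_splits)
      then show "equivclp r s t" by auto
    qed
  qed
  ultimately show ?thesis by simp
qed

text \<open>Exactly one of \<open>piece_to M p\<close> and \<open>piece_to M q\<close> has colour
  \<open>True\<close>, and up to exchanging \<open>p\<close> and \<open>q\<close> it is the former.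
  Of the three matchings of the four ends, the one joining \<open>piece_to M p\<close> to
  \<open>From p\<close> is missing.\<close>

lemma cut_crossing:
  assumes p: "p \<in> M" "opp p = q" "p \<noteq> q" "ori p"
  defines "R \<equiv> equivclp (join M opp ori (M - {p, q}))"
  shows "\<not> R (piece_to M p) (From p)"
    and "R (From q) (piece_to M p) \<and> R (piece_to M q) (From p) \<or>
      R (From q) (From p) \<and> R (piece_to M q) (piece_to M p)"
proof -
  have q: "q \<in> M" "opp q = p" "ori q" using p by auto
  have "(R (From q) (piece_to M p) \<and> R (piece_to M q) (From p) \<or>
      R (From q) (From p) \<and> R (piece_to M q) (piece_to M p)) \<and> \<not> R (piece_to M p) (From p)"
  proof (cases "col (piece_to M p)")
    case True
    then show ?thesis using cut_crossing_aux[OF p(1)] p unfolding R_def by auto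
  next
    case False
    then have "col (piece_to M q)" using col_opp'[OF p(1)] p by simp
    then have "(R (From p) (piece_to M q) \<and> R (piece_to M p) (From q) \<or>
      R (From p) (From q) \<and> R (piece_to M p) (piece_to M q)) \<and> \<not> R (piece_to M q) (From q)"
      using cut_crossing_aux[OF q(1)] q p unfolding R_def by (simp add: insert_commute)
    then show ?thesis unfolding R_def by (meson equivclp_sym equivclp_trans)
  qed
  then show "\<not> R (piece_to M p) (From p)"
    and "R (From q) (piece_to M p) \<and> R (piece_to M q) (From p) \<or>
      R (From q) (From p) \<and> R (piece_to M q) (piece_to M p)" by auto
qed

end

lemma equivclp_cong:
  assumes "\<And>s t. r s t \<Longrightarrow> r' s t \<or> r' t s" "\<And>s t. r' s t \<Longrightarrow> r s t \<or> r t s"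
  shows "equivclp r = equivclp r'"
proof (intro ext iffI)
  show "equivclp r x y \<Longrightarrow> equivclp r' x y" for x y
    by (rule equivclp_mono'[of r]) (use assms(1) in blast)
  show "equivclp r' x y \<Longrightarrow> equivclp r x y" for x y
    by (rule equivclp_mono'[of r']) (use assms(2) in blast)
qed

lemma comps_cong: "equivclp r = equivclp r' \<Longrightarrow> comps P r = comps P r'"
  by (simp add: comps_def)

lemma card_comps_two_edges:
  assumes "equivclp r u v" "equivclp r u' v'"
  shows "card (comps P (add_edge u' v' (add_edge u v r))) = card (comps P r)"
  using assms by (simp add: comps_cong[OF equivclp_add_edge_redundant] equivclp_add_edge_redundant)

lemma card_comps_two_parallel_edges:
  assumes "finite P" "u \<in> P" "v \<in> P" "\<not> equivclp r u v"
    and "equivclp r u' u \<and> equivclp r v' v \<or> equivclp r u' v \<and> equivclp r v' u"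
  shows "Suc (card (comps P (add_edge u' v' (add_edge u v r)))) = card (comps P r)"
proof -
  have "equivclp (add_edge u v r) u' v'" using assms(5) by (auto simp: equivclp_add_edge)
  then show ?thesis
    using card_comps_add_edge[OF assms(1-4)] by (simp add: comps_cong[OF equivclp_add_edge_redundant])
qed

lemma join_split:
  assumes "p \<in> M" "q \<in> M"
  shows "join M opp ori M s t \<longleftrightarrow>
    join M opp ori (M - {p, q}) s t \<or> join M opp ori {p} s t \<or> join M opp ori {q} s t"
  unfolding join_def using assms by blast

context coloured_loops
begin

text \<open>Each way of joining adds two edges to the graph \<open>G\<close> with the crossing cut
  open. Edges parallel to the outside paths are both redundant; otherwise the first edge merges the
  two paths and the second is redundant, which costs one loop.\<close>

lemma card_comps_crossing:
  assumes p: "p \<in> M" "opp p = q" "p \<noteq> q" "ori p"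
  defines "R \<equiv> equivclp (join M opp ori (M - {p, q}))"
    and "N f g \<equiv> card (comps S (join M f g M))"
    and "opp' \<equiv> opp(p := p, q := q)" and "ori' \<equiv> ori(p := False, q := False)"
  shows "R (From q) (piece_to M p) \<and> R (piece_to M q) (From p) \<Longrightarrow>
      N opp ori = Suc (N opp' ori) \<and> N opp ori' = N opp' ori"
    and "R (From q) (From p) \<and> R (piece_to M q) (piece_to M p) \<Longrightarrow>
      N opp ori = N opp' ori \<and> N opp ori' = Suc (N opp' ori)"
proof -
  define G where "G = join M opp ori (M - {p, q})"
  have q: "q \<in> M" "opp q = p" "ori q" using p by auto
  have G': "join M opp' ori (M - {p, q}) = G" "join M opp ori' (M - {p, q}) = G"
    unfolding G_def by (rule join_cong; simp add: opp'_def ori'_def)+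
  have at: "opp' p = p" "opp' q = q" "\<not> ori' p" "\<not> ori' q"
    using p(3) by (simp_all add: opp'_def ori'_def)
  note split = join_split[OF p(1) q(1)] add_edge_def join_def[of _ _ _ "{_}"]
  have N: "N opp ori =
      card (comps S (add_edge (piece_to M q) (From p) (add_edge (piece_to M p) (From q) G)))"
    unfolding N_def
    by (rule arg_cong[where f = card], rule comps_cong, rule equivclp_cong)
      (simp_all only: split G_def[symmetric] p q bex_simps if_True simp_thms, blast+)
  have N1: "N opp' ori =
      card (comps S (add_edge (piece_to M q) (From q) (add_edge (piece_to M p) (From p) G)))"
    unfolding N_def
    by (rule arg_cong[where f = card], rule comps_cong, rule equivclp_cong)
      (simp_all only: split G' at p(4) q(3) bex_simps if_True simp_thms, blast+)
  have N2: "N opp ori' =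
      card (comps S (add_edge (From p) (From q) (add_edge (piece_to M p) (piece_to M q) G)))"
    unfolding N_def
    by (rule arg_cong[where f = card], rule comps_cong, rule equivclp_cong)
      (simp_all only: split G' at p(2) q(2) bex_simps if_False simp_thms, blast+)
  have ne: "\<not> equivclp G (piece_to M p) (From p)" using cut_crossing(1)[OF p] by (simp add: G_def)
  have in_S: "piece_to M p \<in> S" "piece_to M q \<in> S" "From p \<in> S" "From q \<in> S" using p q by auto
  note eqv = equivclp_sym[of G] equivclp_trans[of G]
  {
    assume "R (From q) (piece_to M p) \<and> R (piece_to M q) (From p)"
    then have c: "equivclp G (From q) (piece_to M p)" "equivclp G (piece_to M q) (From p)"
      by (simp_all add: R_def G_def)
    have "N opp ori = card (comps S G)"
      unfolding N by (rule card_comps_two_edges) (use c eqv in blast)+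
    moreover have "Suc (N opp' ori) = card (comps S G)"
      unfolding N1 by (rule card_comps_two_parallel_edges[OF finite_pieces])
        (use c ne in_S eqv in \<open>blast+\<close>)
    moreover have "Suc (N opp ori') = card (comps S G)"
      unfolding N2 by (rule card_comps_two_parallel_edges[OF finite_pieces])
        (use c ne in_S eqv in \<open>blast+\<close>)
    ultimately show "N opp ori = Suc (N opp' ori) \<and> N opp ori' = N opp' ori" by simp
  }
  {
    assume "R (From q) (From p) \<and> R (piece_to M q) (piece_to M p)"
    then have c: "equivclp G (From q) (From p)" "equivclp G (piece_to M q) (piece_to M p)"
      by (simp_all add: R_def G_def)
    have "Suc (N opp ori) = card (comps S G)"
      unfolding N by (rule card_comps_two_parallel_edges[OF finite_pieces])
        (use c ne in_S eqv in \<open>blast+\<close>)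
    moreover have "Suc (N opp' ori) = card (comps S G)"
      unfolding N1 by (rule card_comps_two_parallel_edges[OF finite_pieces])
        (use c ne in_S eqv in \<open>blast+\<close>)
    moreover have "N opp ori' = card (comps S G)"
      unfolding N2 by (rule card_comps_two_edges) (use c eqv in blast)+
    ultimately show "N opp ori = N opp' ori \<and> N opp ori' = Suc (N opp' ori)" by simp
  }
qed

end

section \<open>Removing virtual marks\<close>

text \<open>Renames pieces when the mark \<open>p\<close> is dropped. Only the piece starting at
  \<open>p\<close> loses its name: it is absorbed into the piece that ends at \<open>p\<close>, or
  becomes a whole loop.\<close>

definition merge_piece :: "point set \<Rightarrow> point \<Rightarrow> piece \<Rightarrow> piece" where
  "merge_piece A p s = (if s = From p then piece_to A p else s)"

lemma merge_piece_simps [simp]: "x \<noteq> p \<Longrightarrow> merge_piece A p (From x) = From x" "merge_piece A p (From p) = piece_to A p"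
  by (simp_all add: merge_piece_def)

lemma merge_piece_piece_to:
  assumes "marks B" "0 \<le> snd m" "snd m < 1"
  shows "merge_piece (B - {p}) p (piece_to B m) = piece_to (B - {p}) m"
proof (cases "\<exists>y\<in>B. fst y = fst m")
  case True
  have "piece_to B m = From (prev_mark B m)"
    using True unfolding piece_to_def image_iff by metis
  moreover have "prev_mark B m \<in> B" using prev_mark_props(1)[OF assms(1) True] .
  ultimately show ?thesis
    using piece_to_subset[OF assms(1), of "B - {p}" m] assms True
    by (cases "prev_mark B m = p") auto
next
  case False
  then show ?thesis by (auto simp: piece_to_def image_iff merge_piece_def)
qed

context marked_loops
begin

text \<open>A mark passed straight through is an edge between the piece ending there and the piece
  starting there; dropping it contracts this edge, or relabels the only piece of a loop. Directions
  are tracked as well, because indices depend on them.\<close>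

lemma remove_virtual:
  assumes p: "p \<in> M" "opp p = p" "ori p"
  shows "marked_loops n (M - {p}) opp ori"
    and "equivclp (djoin M opp ori M) z w \<Longrightarrow>
      equivclp (djoin (M - {p}) opp ori (M - {p}))
        (apfst (merge_piece (M - {p}) p) z) (apfst (merge_piece (M - {p}) p) w)"
    and "card (comps (pieces_of n (M - {p})) (join (M - {p}) opp ori (M - {p}))) =
      card (comps S (join M opp ori M))"
proof -
  let ?A = "M - {p}"
  let ?m = "merge_piece ?A p"
  have opp_ne: "opp x \<noteq> p" if "x \<in> ?A" for x using that p by (metis Diff_iff insertI1 opp_opp)
  show loc: "marked_loops n ?A opp ori"
    using marks_subset[OF marks, of ?A] fst_less opp_ne ori_fixed by unfold_locales auto
  have m_to: "?m (piece_to M x) = piece_to ?A x" if "x \<in> M" for x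
    using merge_piece_piece_to[OF marks, of x p] marks_bounds[OF marks that] by simp
  have m_p: "?m (piece_to M p) = ?m (From p)" using m_to[OF p(1)] by simp
  have step: "equivclp (djoin ?A opp ori ?A) (apfst ?m z) (apfst ?m w)"
    if "djoin M opp ori M z w" for z w
  proof -
    obtain x where x: "x \<in> M" "if ori x then fst z = piece_to M x \<and> fst w = From (opp x) \<and> snd w = snd z
       else (fst z = piece_to M x \<and> fst w = piece_to M (opp x) \<or>
             fst z = From x \<and> fst w = From (opp x)) \<and> snd w = (\<not> snd z)"
      using \<open>djoin M opp ori M z w\<close> unfolding djoin_def by blast
    show ?thesis
    proof (cases "x = p")
      case True
      then have "fst z = piece_to M p \<and> fst w = From p \<and> snd w = snd z" using x p by auto
      then have "apfst ?m z = apfst ?m w"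
        using m_p by (cases z; cases w) (simp del: piece_to_in merge_piece_simps)
      then show ?thesis by simp
    next
      case False
      then have "djoin ?A opp ori ?A (apfst ?m z) (apfst ?m w)"
        unfolding djoin_def using x opp_ne[of x] m_to[of x] m_to[of "opp x"]
        by (intro bexI[of _ x]) (auto simp del: piece_to_in split: if_splits)
      then show ?thesis by auto
    qed
  qed
  show "equivclp (djoin ?A opp ori ?A) (apfst ?m z) (apfst ?m w)"
    if "equivclp (djoin M opp ori M) z w"
    using that step by (rule equivclp_transfer)
  have img: "?m ` S = pieces_of n ?A"
  proof (intro subset_antisym subsetI)
    fix s assume "s \<in> ?m ` S"
    then obtain t where t: "t \<in> S" "s = ?m t" by auto
    show "s \<in> pieces_of n ?A"
    proof (cases "t = From p")
      case True
      then have s: "s = piece_to ?A p" using t by simp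
      show ?thesis
      proof (cases "fst p \<in> fst ` ?A")
        case True
        then have "\<exists>y\<in>?A. fst y = fst p" by (metis imageE)
        from prev_mark_props(1)[OF marks_subset[OF marks Diff_subset] this]
        have "prev_mark ?A p \<in> ?A" .
        then show ?thesis using True s by (auto simp: piece_to_def pieces_of_def)
      next
        case False
        then show ?thesis using s p fst_less by (auto simp: piece_to_def pieces_of_def)
      qed
    next
      case False
      then show ?thesis using t by (auto simp: pieces_of_def merge_piece_def)
    qed
  next
    fix s assume s: "s \<in> pieces_of n ?A"
    show "s \<in> ?m ` S"
    proof (cases "s \<in> S")
      case True
      have "s \<noteq> From p" using s by (auto simp: pieces_of_def)
      then show ?thesis using True by (intro image_eqI[of _ _ s]) (auto simp: merge_piece_def)
    next
      case False
      then obtain k where k: "s = Whole k" "k \<notin> fst ` ?A" "k \<in> fst ` M"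
        using s by (auto simp: pieces_of_def)
      then obtain y where "y \<in> M" "k = fst y" by auto
      then have "k = fst p" using k(2) by (cases "y = p") auto
      then have "s = ?m (From p)" using k by (simp add: piece_to_def)
      then show ?thesis using p(1) by (intro image_eqI[of _ _ "From p"]) auto
    qed
  qed
  \<comment> \<open>Two distinct pieces share an image only if they are \<open>From p\<close> and
    the piece ending at \<open>p\<close>, and these are joined at \<open>p\<close>.\<close>
  have fibre: "equivclp (join M opp ori M) (From p) b" if b: "b \<in> S" "b = piece_to ?A p" for b
  proof -
    have "fst p \<in> fst ` ?A"
      using b p by (auto simp: piece_to_def pieces_of_def split: if_splits)
    then obtain y where "y \<in> M" "y \<noteq> p" "fst y = fst p" by force
    then have "prev_mark M p \<noteq> p" using prev_mark_self[OF marks p(1)] by blast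
    then have "b = piece_to M p" using m_to[OF p(1)] b p by simp
    then have "join M opp ori M b (From p)" using p unfolding join_def by auto
    then show ?thesis by auto
  qed
  show "card (comps (pieces_of n ?A) (join ?A opp ori ?A)) = card (comps S (join M opp ori M))"
    unfolding img[symmetric]
  proof (rule card_comps_contract)
    fix a b assume "join M opp ori M a b"
    then obtain b' where "djoin M opp ori M (a, True) (b, b')" using join_djoin by blast
    from step[OF this] have "equivclp (djoin ?A opp ori ?A) (?m a, True) (?m b, b')" by simp
    then have "equivclp (join ?A opp ori ?A) (fst (?m a, True)) (fst (?m b, b'))"
      by (rule equivclp_transfer) (rule r_into_equivclp, rule djoin_join)
    then show "equivclp (join ?A opp ori ?A) (?m a) (?m b)" by simp
  next
    fix a' b' assume "join ?A opp ori ?A a' b'"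
    then obtain x where x: "x \<in> M" "x \<noteq> p" 
      "if ori x then a' = piece_to ?A x \<and> b' = From (opp x)
       else (a' = piece_to ?A x \<and> b' = piece_to ?A (opp x) \<or> a' = From x \<and> b' = From (opp x))"
      unfolding join_def by auto
    have "\<exists>a\<in>S. \<exists>b\<in>S. ?m a = a' \<and> ?m b = b' \<and> (if ori x
        then a = piece_to M x \<and> b = From (opp x)
        else (a = piece_to M x \<and> b = piece_to M (opp x) \<or> a = From x \<and> b = From (opp x)))"
    proof -
      have S: "piece_to M x \<in> S" "piece_to M (opp x) \<in> S" "From x \<in> S" "From (opp x) \<in> S"
        using x by auto
      have m: "?m (piece_to M x) = piece_to ?A x" "?m (piece_to M (opp x)) = piece_to ?A (opp x)"
        "?m (From x) = From x" "?m (From (opp x)) = From (opp x)"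
        using x m_to opp_ne[of x] by (auto simp del: piece_to_in)
      consider "ori x" "a' = piece_to ?A x" "b' = From (opp x)"
        | "\<not> ori x" "a' = piece_to ?A x" "b' = piece_to ?A (opp x)"
        | "\<not> ori x" "a' = From x" "b' = From (opp x)"
        using x(3) by (auto split: if_splits)
      then show ?thesis by cases (use S m in metis)+
    qed
    then show "\<exists>a\<in>S. \<exists>b\<in>S. ?m a = a' \<and> ?m b = b' \<and> equivclp (join M opp ori M) a b"
      using x(1) unfolding join_def by (blast intro: r_into_equivclp)
  next
    fix a b assume ab: "a \<in> S" "b \<in> S" "?m a = ?m b"
    show "equivclp (join M opp ori M) a b"
    proof (cases "a = b")
      case False
      then have "a = From p \<and> b = piece_to ?A p \<or> b = From p \<and> a = piece_to ?A p"
        using ab(3) by (auto simp: merge_piece_def split: if_splits)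
      then show ?thesis using fibre ab equivclp_sym by metis
    qed simp
  qed
qed

end

context coloured_loops
begin

text \<open>
  Here \<open>along\<close> tells whether the two smoothings of the crossing \<open>{p, q}\<close> are such that the
  orientation-respecting one has one loop more than the other one.
\<close>

lemma smoothings_of_crossing:
  assumes p: "p \<in> M" "opp p = q" "p \<noteq> q" "ori p"
  defines "A \<equiv> M - {p, q}"
    and "N \<equiv> \<lambda>M ori. card (comps (pieces_of n M) (join M opp ori M))"
  shows "marked_loops n A opp ori"
    and "\<exists>along. N M ori = (if along then Suc (N A ori) else N A ori) \<and>
      N M (ori(p := False, q := False)) = (if along then N A ori else Suc (N A ori)) \<and>
      (\<forall>b. equivclp (djoin A opp ori A) (piece_to A p, b) (piece_to A q, b = along))"
proof -
  \<comment> \<open>Both points become pass-through marks and are then dropped one after the other,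
    which leads from \<open>M\<close> to the marks \<open>A\<close> of the virtual diagram.\<close>
  define opp' where "opp' = opp(p := p, q := q)"
  define R where "R = equivclp (join M opp ori A)"
  have q: "q \<in> M" "opp q = p" "ori q" using p by auto
  have opp_eq: "opp x = p \<longleftrightarrow> x = q" "opp x = q \<longleftrightarrow> x = p" if "x \<in> M" for x
    using that p q by (metis opp_opp)+
  have opp'_eq: "opp' p = p" "opp' q = q" "x \<noteq> p \<Longrightarrow> x \<noteq> q \<Longrightarrow> opp' x = opp x" for x
    by (simp_all add: opp'_def)
  interpret V: marked_loops n M opp' ori
  proof
    show "ori x" if "x \<in> M" "opp' x = x" for x
      using that p(4) q(3) ori_fixed[of x] opp'_eq by metis
  next
    fix x assume x: "x \<in> M"
    show "opp' x \<in> M" "opp' (opp' x) = x" "ori (opp' x) = ori x"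
      using x opp'_eq opp_eq by (metis opp_in, metis opp_opp, metis ori_opp)
  qed (use marks fst_less in auto)
  have Vq: "q \<in> M" "opp' q = q" "ori q" using q by (auto simp: opp'_def)
  interpret V1: marked_loops n "M - {q}" opp' ori by (rule V.remove_virtual(1)[OF Vq])
  have Vp: "p \<in> M - {q}" "opp' p = p" "ori p" using p by (auto simp: opp'_def)
  have A: "M - {q} - {p} = A" by (auto simp: A_def)
  have cong: "djoin B opp' ori A = djoin B opp ori A" "join B opp' ori A = join B opp ori A" for B
    by (rule djoin_cong join_cong; auto simp: A_def opp'_def)+
  show "marked_loops n A opp ori"
    by unfold_locales (use marks_subset[OF marks, of A] fst_less opp_eq ori_fixed in \<open>auto simp: A_def\<close>)
  have N_A: "N A ori = card (comps S (join M opp' ori M))"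
    using V1.remove_virtual(3)[OF Vp] V.remove_virtual(3)[OF Vq] by (simp add: N_def A cong)
  have transfer: "equivclp (djoin A opp ori A)
      (merge_piece A p (merge_piece (M - {q}) q s), b) (merge_piece A p (merge_piece (M - {q}) q t), c)"
    if "equivclp (djoin M opp' ori M) (s, b) (t, c)" for s t b c
    using V1.remove_virtual(2)[OF Vp V.remove_virtual(2)[OF Vq that]] by (simp add: A cong)
  have to: "merge_piece A p (merge_piece (M - {q}) q (piece_to M x)) = piece_to A x" if "x \<in> M" for x
    using merge_piece_piece_to[OF marks, of x q] merge_piece_piece_to[OF V1.marks, of x p]
      marks_bounds[OF marks that] by (simp add: A del: piece_to_in)
  have from_p: "merge_piece A p (merge_piece (M - {q}) q (From p)) = piece_to A p"
    using p by simp
  have "equivclp (djoin M opp' ori M) (piece_to M q, b) (From q, b)" for b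
  proof -
    have "djoin M opp' ori M (piece_to M q, b) (From q, b)"
      using Vq unfolding djoin_def by auto
    then show ?thesis by auto
  qed
  then have from_q: "equivclp (djoin A opp ori A)
      (piece_to A q, b) (merge_piece A p (merge_piece (M - {q}) q (From q)), b)" for b
    using transfer to[OF q(1)] by metis
  have directed: "equivclp (djoin M opp' ori M) (s, col s = b) (t, col t = b)" if "R s t" for s t b
  proof -
    have "equivclp (djoin M opp ori A) (s, col s = b) (t, col t = b)"
      using equivclp_join_djoin[of A] that by (auto simp: R_def A_def)
    then show ?thesis
      unfolding cong(1)[symmetric]
      by (rule equivclp_mono'[rotated]) (auto simp: A_def intro: djoin_mono)
  qed
  have cols: "col (From q) = col (piece_to M p)" "col (From p) = (\<not> col (piece_to M p))"
    "col (piece_to M q) = (\<not> col (piece_to M p))"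
    using col_opp[OF p(1)] col_pass[OF p(1)] col_opp'[OF p(1)] p by (simp_all del: piece_to_in)
  from cut_crossing(2)[OF p]
  show "\<exists>along. N M ori = (if along then Suc (N A ori) else N A ori) \<and>
      N M (ori(p := False, q := False)) = (if along then N A ori else Suc (N A ori)) \<and>
      (\<forall>b. equivclp (djoin A opp ori A) (piece_to A p, b) (piece_to A q, b = along))"
  proof
    assume *: "equivclp (join M opp ori (M - {p, q})) (From q) (piece_to M p) \<and>
      equivclp (join M opp ori (M - {p, q})) (piece_to M q) (From p)"
    \<comment> \<open>The pieces \<open>piece_to M q\<close> and \<open>From p\<close> have equal
      colours, so the path between them keeps its sense relative to the orientation of the
      loops.\<close>
    have "equivclp (djoin A opp ori A) (piece_to A p, b) (piece_to A q, b = True)" for b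
      using transfer[OF directed, of "piece_to M q" "From p" "col (From p) = b"] * cols
        equivclp_sym[of "djoin A opp ori A"]
      by (cases b; cases "col (piece_to M p)")
        (auto simp: R_def A_def[symmetric] to[OF q(1)] from_p simp del: piece_to_in)
    then show ?thesis
      using card_comps_crossing(1)[OF p *]
      by (intro exI[of _ True]) (simp add: N_def N_A[unfolded N_def] opp'_def)
  next
    assume *: "equivclp (join M opp ori (M - {p, q})) (From q) (From p) \<and>
      equivclp (join M opp ori (M - {p, q})) (piece_to M q) (piece_to M p)"
    \<comment> \<open>Now the path ends at two pieces of opposite colours, so the sense is
      reversed.\<close>
    have "equivclp (djoin A opp ori A) (piece_to A p, b) (piece_to A q, b = False)" for b
      using transfer[OF directed, of "piece_to M q" "piece_to M p" "col (piece_to M p) = b"] * cols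
        equivclp_sym[of "djoin A opp ori A"]
      by (cases b; cases "col (piece_to M p)")
        (auto simp: R_def A_def[symmetric] to[OF q(1)] to[OF p(1)] simp del: piece_to_in)
    then show ?thesis
      using card_comps_crossing(2)[OF p *]
      by (intro exI[of _ False]) (simp add: N_def N_A[unfolded N_def] opp'_def)
  qed
qed

end

section \<open>Diagrams\<close>

abbreviation loop_count :: "diagram \<Rightarrow> nat" where
  "loop_count D \<equiv> length (curves D)"

definition ori_at :: "diagram \<Rightarrow> state \<Rightarrow> point \<Rightarrow> bool" where
  "ori_at D \<sigma> x = oriented_splice D \<sigma> (crossing_at D x)"

lemma double_points_sym: "(p, q) \<in> double_points D \<Longrightarrow> (q, p) \<in> double_points D"
  by (auto simp: double_points_def)

context
  fixes D assumes vld: "virtual_link_diagram D"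
begin

lemma finite_classical: "finite (classical D)"
proof -
  have "classical D \<subseteq> double_points D" "finite (double_points D)"
    using vld unfolding virtual_link_diagram_def by simp_all
  then show ?thesis by (rule finite_subset)
qed

lemma classical_double: "c \<in> classical D \<Longrightarrow> c \<in> double_points D"
proof -
  have "classical D \<subseteq> double_points D" using vld unfolding virtual_link_diagram_def by simp
  then show "c \<in> classical D \<Longrightarrow> c \<in> double_points D" ..
qed

lemma classical_unique:
  assumes "c \<in> classical D" "c' \<in> classical D" "x = fst c \<or> x = snd c" "x = fst c' \<or> x = snd c'"
  shows "c = c'"
proof -
  obtain p q where c: "c = (p, q)" by (cases c)
  obtain p' q' where c': "c' = (p', q')" by (cases c')
  have uniq: "\<And>p q r. (p, q) \<in> double_points D \<Longrightarrow> (p, r) \<in> double_points D \<Longrightarrow> q = r"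
    and asym: "\<And>p q. (p, q) \<in> classical D \<Longrightarrow> (q, p) \<notin> classical D"
    using vld unfolding virtual_link_diagram_def by (blast, fast)
  have d: "(p, q) \<in> double_points D" "(p', q') \<in> double_points D"
    "(q, p) \<in> double_points D" "(q', p') \<in> double_points D"
    using assms c c' classical_double double_points_sym by metis+
  consider "p = p'" | "p = q'" | "q = p'" | "q = q'" using assms(3,4) c c' by auto
  then show ?thesis
  proof cases
    case 1 then show ?thesis using uniq[of p q q'] d c c' by simp
  next
    case 2
    then have "q = p'" using uniq[of p q p'] d by simp
    then show ?thesis using asym assms(1,2) 2 c c' by blast
  next
    case 3
    then have "p = q'" using uniq[of q p q'] d by simp
    then show ?thesis using asym assms(1,2) 3 c c' by blast
  next
    case 4 then show ?thesis using uniq[of q p p'] d c c' by simp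
  qed
qed

lemma crossing_at_eq:
  assumes "c \<in> classical D" "x = fst c \<or> x = snd c"
  shows "crossing_at D x = c"
  unfolding crossing_at_def using assms classical_unique by (intro the_equality) blast+

lemma crossing_at_props:
  assumes "x \<in> classical_points D"
  shows "crossing_at D x \<in> classical D" "x = fst (crossing_at D x) \<or> x = snd (crossing_at D x)"
  using assms crossing_at_eq unfolding classical_points_def by auto

lemma classical_distinct: "c \<in> classical D \<Longrightarrow> fst c \<noteq> snd c"
  using classical_double by (fastforce simp: double_points_def)

lemma partner_eq:
  assumes "c \<in> classical D"
  shows "partner D (fst c) = snd c" "partner D (snd c) = fst c"
  using crossing_at_eq[OF assms] classical_distinct[OF assms] by (auto simp: partner_def)

lemma classical_points_double:
  assumes "x \<in> classical_points D"
  shows "x \<in> fst ` double_points D"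
proof -
  obtain c where c: "c \<in> classical D" "x = fst c \<or> x = snd c"
    using assms by (auto simp: classical_points_def)
  then have "(fst c, snd c) \<in> double_points D" "(snd c, fst c) \<in> double_points D"
    using classical_double[OF c(1)] double_points_sym by auto
  then show ?thesis using c(2) by (metis fst_conv image_eqI)
qed

lemma double_points_marks: "marks (fst ` double_points D)"
  unfolding marks_def
proof
  show "finite (fst ` double_points D)" using vld by (simp add: virtual_link_diagram_def)
  show "snd ` fst ` double_points D \<subseteq> {0..<1}" by (auto simp: double_points_def points_def)
qed

lemma classical_points_marks: "marks (classical_points D)"
  by (rule marks_subset[OF double_points_marks]) (use classical_points_double in blast)

lemma diagram_marked_loops:
  "marked_loops (loop_count D) (classical_points D) (partner D) (ori_at D \<sigma>)"
proof
  show "fst ` classical_points D \<subseteq> {..<loop_count D}"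
    using classical_points_double by (fastforce simp: double_points_def points_def)
next
  fix x assume x: "x \<in> classical_points D"
  define c where "c = crossing_at D x"
  have c: "c \<in> classical D" "x = fst c \<or> x = snd c" using crossing_at_props[OF x] by (auto simp: c_def)
  note partner_eq[OF c(1)] crossing_at_eq[OF c(1), of "fst c"] crossing_at_eq[OF c(1), of "snd c"]
  then show "partner D x \<in> classical_points D" "partner D (partner D x) = x"
    "ori_at D \<sigma> (partner D x) = ori_at D \<sigma> x"
    using c by (auto simp: classical_points_def ori_at_def)
  show "ori_at D \<sigma> x" if "partner D x = x"
    using that c partner_eq[OF c(1)] classical_distinct[OF c(1)] by auto
qed (rule classical_points_marks)

lemma travel_eq: "travel D \<sigma> = trav (classical_points D) (partner D) (ori_at D \<sigma>)"
proof
  fix z show "travel D \<sigma> z = trav (classical_points D) (partner D) (ori_at D \<sigma>) z"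
    by (cases z rule: directed_cases) (simp_all add: ori_at_def Let_def)
qed

lemma semi_arcs_eq: "semi_arcs D = pieces_of (loop_count D) (classical_points D)"
  by (simp add: semi_arcs_def pieces_def pieces_of_def)

lemma state_loops_eq:
  "state_loops D \<sigma> =
     comps (semi_arcs D) (join (classical_points D) (partner D) (ori_at D \<sigma>) (classical_points D))"
proof -
  interpret marked_loops "loop_count D" "classical_points D" "partner D" "ori_at D \<sigma>"
    by (rule diagram_marked_loops)
  show ?thesis
    unfolding state_loops_def comps_def travel_eq semi_arcs_eq using fst_orbit_trav by blast
qed

end

section \<open>Cut points and indices\<close>

abbreviation dir_sign :: "piece \<times> bool \<Rightarrow> int" where
  "dir_sign z \<equiv> (if snd z then 1 else - 1)"

text \<open>The weight \<open>W\<close> is the coboundary of a potential \<open>h\<close> that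
  agrees at the two points of a crossing, so its sum over a closed path vanishes.\<close>

lemma (in marked_loops) sum_orbit_telescope:
  fixes W :: "piece \<Rightarrow> int" and h :: "point \<Rightarrow> int"
  assumes z: "fst z \<in> S"
    and h: "\<And>x. x \<in> M \<Longrightarrow> h (opp x) = h x"
    and W_From: "\<And>x. x \<in> M \<Longrightarrow> W (From x) = h (next_mark M x) - h x"
    and W_Whole: "\<And>k. W (Whole k) = 0"
  shows "(\<Sum>w\<in>orbit T z. dir_sign w * W (fst w)) = 0"
proof -
  let ?O = "orbit T z"
  \<comment> \<open>The potential at the point where the traversal enters \<open>w\<close>; leaving
    \<open>w\<close> means entering \<open>T w\<close>.\<close>
  define H where "H w = (case fst w of Whole k \<Rightarrow> 0 | From x \<Rightarrow> h (if snd w then x else next_mark M x))"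
    for w :: "piece \<times> bool"
  have O_S: "fst w \<in> S" if "w \<in> ?O" for w using orbit_in[OF that z] .
  have "dir_sign w * W (fst w) = H (T w) - H w" if "w \<in> ?O" for w
  proof (cases w rule: directed_cases)
    case (Whole k b)
    then show ?thesis by (simp add: W_Whole H_def)
  next
    case (From x b)
    then have "From x \<in> S" using O_S[OF that] by simp
    then have x: "x \<in> M" unfolding From_in .
    then show ?thesis using From W_From[OF x] h
      by (auto simp: H_def Let_def)
  qed
  then have "(\<Sum>w\<in>?O. dir_sign w * W (fst w)) = (\<Sum>w\<in>?O. H (T w)) - (\<Sum>w\<in>?O. H w)"
    by (simp add: sum_subtractf)
  also have "(\<Sum>w\<in>?O. H (T w)) = (\<Sum>w\<in>?O. H w)"
  proof -
    have fin: "finite ?O" using finite_orbit self_in_orbit z by metis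
    have inj: "inj_on T ?O" using trav_inj O_S by (auto intro: inj_on_subset)
    have "T ` ?O = ?O" using fin inj by (intro endo_inj_surj) (auto intro: orbit.step)
    then show ?thesis using sum.reindex[OF inj, of H] by simp
  qed
  finally show ?thesis by simp
qed

text \<open>The jump of an Alexander numbering along the strand through \<open>x\<close>: 1 on the
  strand from bottom left to top right, -1 on the other one.\<close>

definition crossing_sign :: "diagram \<Rightarrow> point \<Rightarrow> int" where
  "crossing_sign D x = (if x = fst (crossing_at D x) \<longleftrightarrow> positive D (crossing_at D x) then 1 else - 1)"

context
  fixes D assumes vld: "virtual_link_diagram D"
begin

lemma alexander_at_crossing:
  assumes "alexander_numbering D C f" "x \<in> classical_points D"
  defines "M \<equiv> classical_points D \<union> fst ` C"
  shows "f (From (partner D x)) = f (piece_to M x)"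
    and "f (From x) = f (piece_to M x) + crossing_sign D x"
proof -
  obtain p q where c: "crossing_at D x = (p, q)" by (cases "crossing_at D x")
  have pq: "(p, q) \<in> classical D" "x = p \<or> x = q" "p \<noteq> q"
    using crossing_at_props[OF vld assms(2)] classical_distinct[OF vld] c by fastforce+
  have "partner D p = q" "partner D q = p" using partner_eq[OF vld pq(1)] by simp_all
  then show "f (From (partner D x)) = f (piece_to M x)"
    "f (From x) = f (piece_to M x) + crossing_sign D x"
    using assms(1) pq c unfolding alexander_numbering_def M_def[symmetric] crossing_sign_def Let_def
    by (fastforce split: if_splits)+
qed

lemma cut_points_marks:
  assumes "cut_points D C"
  shows "marks (classical_points D \<union> fst ` C)"
proof -
  have "snd m \<in> {0..<1}" if "m \<in> fst ` C" for m
  proof -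
    have "m \<in> points D" using assms that unfolding cut_points_def by blast
    then show ?thesis by (auto simp: points_def)
  qed
  then have "snd ` fst ` C \<subseteq> {0..<1}" by blast
  then show ?thesis
    using assms classical_points_marks[OF vld] by (simp add: marks_def cut_points_def image_Un)
qed

text \<open>Along a semi-arc the numbering changes at cut points only, so their signs telescope to
  the difference of its end values.\<close>

lemma cut_count_arc:
  assumes C: "cut_points D C" and f: "alexander_numbering D C f"
  defines "M \<equiv> classical_points D \<union> fst ` C"
    and "W s \<equiv> (\<Sum>c\<in>{c \<in> C. piece_to (classical_points D) (fst c) = s}. cut_sign c)"
  shows "x \<in> classical_points D \<Longrightarrow>
      W (From x) = f (piece_to M (next_mark (classical_points D) x)) - f (From x)"
    and "W (Whole k) = 0"
proof -
  let ?A = "classical_points D"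
  have disj: "fst ` C \<inter> ?A = {}"
    using C classical_points_double[OF vld] unfolding cut_points_def by blast
  have A: "marks ?A" using classical_points_marks[OF vld] .
  have M: "marks M" using cut_points_marks[OF C] by (simp add: M_def)
  have sub: "?A \<subseteq> M" by (simp add: M_def)
  have W: "W s = (\<Sum>m\<in>{m \<in> M - ?A. piece_to ?A m = s}. f (From m) - f (From (prev_mark M m)))" for s
  proof -
    have img: "{m \<in> M - ?A. piece_to ?A m = s} = fst ` {c \<in> C. piece_to ?A (fst c) = s}"
      using disj by (auto simp: M_def)
    have inj: "inj_on fst {c \<in> C. piece_to ?A (fst c) = s}"
      using C unfolding cut_points_def by (auto intro: inj_on_subset)
    have "cut_sign c = f (From (fst c)) - f (From (prev_mark M (fst c)))" if "c \<in> C" for c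
      using f that piece_to_mark[of "fst c" M]
      unfolding alexander_numbering_def M_def Let_def by auto
    then show ?thesis unfolding W_def img sum.reindex[OF inj] by (auto intro: sum.cong)
  qed
  show "W (From x) = f (piece_to M (next_mark ?A x)) - f (From x)" if "x \<in> ?A"
  proof -
    have "next_mark ?A x \<in> M" using A that sub by auto
    then show ?thesis
      unfolding W using sum_piece[OF M sub that, of "\<lambda>m. f (From m)"] by (simp add: piece_to_mark)
  qed
  show "W (Whole k) = 0"
    unfolding W using sum_whole_loop[OF M sub, of "\<lambda>m. f (From m)" k] .
qed

text \<open>
  The difference of two numberings is the same for all four pieces at a crossing.  Hence the signed
  number of cut points on a closed path does not depend on the cut system, and can also be computed
  from the jumps of any numbering \<open>inn\<close> (before the marks), \<open>out\<close> (after the marks) that satisfies the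
  conditions at the crossings.
\<close>

lemma sum_cut_count:
  fixes inn out :: "point \<Rightarrow> int"
  assumes C: "cut_system D C" and z: "fst z \<in> semi_arcs D"
    and out_opp: "\<And>x. x \<in> classical_points D \<Longrightarrow> out (partner D x) = inn x"
    and out_jump: "\<And>x. x \<in> classical_points D \<Longrightarrow> out x = inn x + crossing_sign D x"
    and W_From: "\<And>x. x \<in> classical_points D \<Longrightarrow>
      W (From x) = inn (next_mark (classical_points D) x) - out x"
    and W_Whole: "\<And>k. W (Whole k) = 0"
  shows "(\<Sum>w\<in>orbit (travel D \<sigma>) z. cut_count D C w) =
    (\<Sum>w\<in>orbit (travel D \<sigma>) z. dir_sign w * W (fst w))"
proof -
  interpret marked_loops "loop_count D" "classical_points D" "partner D" "ori_at D \<sigma>"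
    by (rule diagram_marked_loops[OF vld])
  obtain f where f: "alexander_numbering D C f" and cp: "cut_points D C"
    using C by (auto simp: cut_system_def)
  let ?M = "classical_points D \<union> fst ` C"
  define V where "V s = (\<Sum>c\<in>{c \<in> C. piece_to (classical_points D) (fst c) = s}. cut_sign c)" for s
  define h where "h x = f (From x) - out x" for x
  have h_in: "h x = f (piece_to ?M x) - inn x" if "x \<in> classical_points D" for x
    using alexander_at_crossing[OF f that] out_jump[OF that] by (simp add: h_def)
  have "(\<Sum>w\<in>orbit T z. dir_sign w * (V (fst w) - W (fst w))) = 0"
  proof (rule sum_orbit_telescope)
    show "fst z \<in> S" using z semi_arcs_eq[OF vld] by simp
    show "h (partner D x) = h x" if "x \<in> classical_points D" for x
      using alexander_at_crossing(1)[OF f that] out_opp[OF that] h_in[OF that] by (simp add: h_def)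
    show "V (From x) - W (From x) = h (next_mark (classical_points D) x) - h x"
      if "x \<in> classical_points D" for x
      using cut_count_arc(1)[OF cp f that] W_From[OF that] h_in[of "next_mark (classical_points D) x"] that
      by (simp add: V_def h_def)
    show "V (Whole k) - W (Whole k) = 0" for k
      using cut_count_arc(2)[OF cp f] W_Whole by (simp add: V_def)
  qed
  moreover have "cut_count D C w = dir_sign w * V (fst w)" for w
    by (simp add: cut_count_def V_def)
  ultimately show ?thesis
    unfolding travel_eq[OF vld] by (simp add: right_diff_distrib sum_subtractf)
qed

lemma loop_props:
  assumes "l \<in> state_loops D \<sigma>"
  shows "(SOME s. s \<in> l) \<in> l" "l \<subseteq> semi_arcs D"
proof -
  interpret marked_loops "loop_count D" "classical_points D" "partner D" "ori_at D \<sigma>"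
    by (rule diagram_marked_loops[OF vld])
  obtain s where s: "s \<in> S" "l = fst ` orbit T (s, True)"
    using assms by (auto simp: state_loops_def travel_eq[OF vld] semi_arcs_eq[OF vld])
  then show "l \<subseteq> semi_arcs D" using orbit_in[of _ "(s, True)"] semi_arcs_eq[OF vld] by auto
  have "l \<noteq> {}" using s(2) orbit_nonempty[of T "(s, True)"] by blast
  then show "(SOME s. s \<in> l) \<in> l" using some_in_eq by blast
qed

text \<open>Comparison of \<open>C\<close> with the empty cut system, whose weights vanish.\<close>

lemma loop_index_almost_classical:
  assumes "almost_classical D" "cut_system D C" "l \<in> state_loops D \<sigma>"
  shows "loop_index D C \<sigma> l = 0"
proof -
  obtain f where f: "alexander_numbering D {} f" using assms(1) by (auto simp: almost_classical_def)
  let ?A = "classical_points D"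
  have A: "marks ?A" using classical_points_marks[OF vld] .
  have "(\<Sum>w\<in>orbit (travel D \<sigma>) (SOME s. s \<in> l, True). cut_count D C w) =
    (\<Sum>w\<in>orbit (travel D \<sigma>) (SOME s. s \<in> l, True). dir_sign w * (\<lambda>_. 0) (fst w))"
  proof (rule sum_cut_count[OF assms(2)])
    show "fst (SOME s. s \<in> l, True) \<in> semi_arcs D" using loop_props[OF assms(3)] by auto
    show "f (From (partner D x)) = f (piece_to ?A x)"
      "f (From x) = f (piece_to ?A x) + crossing_sign D x" if "x \<in> ?A" for x
      using alexander_at_crossing[OF f that] by simp_all
    show "0 = f (piece_to ?A (next_mark ?A x)) - f (From x)" if "x \<in> ?A" for x
      using A that by (simp add: piece_to_mark)
  qed simp
  then show ?thesis by (simp add: loop_index_def)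
qed

text \<open>Number every crossing with i = 0, so that all values at crossings are 0 or 1. The
  mismatch \<open>N x\<close> between the two ends of a semi-arc is then -1, 0 or 1, and one cut
  point just after its start repairs it. Existence gives the \<open>SOME\<close> in
  \<open>multivariable_polynomial\<close> its meaning.\<close>

lemma cut_system_exists: "\<exists>C. cut_system D C"
proof -
  let ?A = "classical_points D" and ?Z = "fst ` double_points D"
  have A: "marks ?A" and Z: "marks ?Z" and AZ: "?A \<subseteq> ?Z"
    using classical_points_marks[OF vld] double_points_marks[OF vld]
      classical_points_double[OF vld] by auto
  have "\<exists>x'. x' \<notin> ?Z \<and> fst x' = fst x \<and> 0 \<le> snd x' \<and> snd x' < 1 \<and> prev_mark ?Z x' = x"
    if "x \<in> ?A" for x
    using ex_point_after[OF Z] that AZ by blast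
  then obtain af where af: "\<And>x. x \<in> ?A \<Longrightarrow> af x \<notin> ?Z" "\<And>x. x \<in> ?A \<Longrightarrow> fst (af x) = fst x"
    "\<And>x. x \<in> ?A \<Longrightarrow> 0 \<le> snd (af x) \<and> snd (af x) < 1" "\<And>x. x \<in> ?A \<Longrightarrow> prev_mark ?Z (af x) = x"
    by metis
  have prev_af: "prev_mark ?A (af x) = x" if "x \<in> ?A" for x
    using prev_mark_subset[OF Z AZ, of "af x"] af that by (metis (no_types, lifting))
  define inn where "inn x = (if crossing_sign D x = 1 then 0 else 1 :: int)" for x
  define out where "out x = (if crossing_sign D x = 1 then 1 else 0 :: int)" for x
  define N where "N x = inn (next_mark ?A x) - out x" for x
  define C where "C = (\<lambda>x. (af x, N x = 1)) ` {x \<in> ?A. N x \<noteq> 0}"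
  define f where "f s = (case s of Whole k \<Rightarrow> 0 | From m \<Rightarrow>
    if m \<in> ?A then out m else inn (next_mark ?A (prev_mark ?A m)))" for s
  let ?M = "?A \<union> fst ` C"
  have C_af: "fst ` C = af ` {x \<in> ?A. N x \<noteq> 0}" by (auto simp: C_def image_image)
  have af_A: "af x \<notin> ?A" if "x \<in> ?A" for x using af(1) that AZ by blast
  have cp: "cut_points D C"
    unfolding cut_points_def
  proof (intro conjI)
    show "finite C" using A by (auto simp: C_def marks_def)
    show "fst ` C \<subseteq> points D - ?Z"
    proof -
      have "fst x < loop_count D" if "x \<in> ?A" for x
        using AZ that by (fastforce simp: double_points_def points_def)
      then show ?thesis unfolding C_af using af by (force simp: points_def mem_Times_iff)
    qed
    have "x = y" if "x \<in> ?A" "y \<in> ?A" "af x = af y" for x y using that prev_af by metis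
    then show "inj_on fst C" unfolding C_def inj_on_def by auto
  qed
  then have M: "marks ?M" by (rule cut_points_marks)
  have f_af: "f (From (af x)) = inn (next_mark ?A x)" "f (From x) = out x" if "x \<in> ?A" for x
    using that prev_af af_A by (simp_all add: f_def)
  \<comment> \<open>Another cut point in between would have the same predecessor in
    \<open>?A\<close>, but each semi-arc carries at most one.\<close>
  have prev_M_af: "prev_mark ?M (af x) = x" if x: "x \<in> ?A" "N x \<noteq> 0" for x
  proof -
    have in_M: "af x \<in> ?M" using x by (auto simp: C_af)
    let ?z = "prev_mark ?M (af x)"
    have "prev_mark ?A (af x) = (if ?z \<in> ?A then ?z else prev_mark ?A ?z)"
    proof (rule prev_mark_subset[OF M])
      show "\<exists>y\<in>?A. fst y = fst (af x)" using x af(2) by metis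
    qed (use af x in auto)
    then have *: "x = (if ?z \<in> ?A then ?z else prev_mark ?A ?z)" using prev_af x by simp
    show ?thesis
    proof (rule ccontr)
      assume ne: "?z \<noteq> x"
      then have "?z \<notin> ?A" using * by auto
      moreover have "?z \<in> ?M" using prev_mark_in[OF M in_M] .
      ultimately obtain y where y: "y \<in> ?A" "?z = af y" by (auto simp: C_af)
      then have "x = y" using * prev_af[of y] \<open>?z \<notin> ?A\<close> by simp
      then have "?z = af x" using y by simp
      then have "x = af x" using prev_mark_self[OF M in_M] x af(2) by simp
      then show False using af_A x by metis
    qed
  qed
  have f_in: "f (piece_to ?M x) = inn x" if x: "x \<in> ?A" for x
  proof -
    let ?z = "prev_mark ?M x"
    have "x \<in> ?M" using x by simp
    then have z: "?z \<in> ?M" "piece_to ?M x = From ?z"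
      using prev_mark_in[OF M] piece_to_mark by metis+
    have "prev_mark ?A x = (if ?z \<in> ?A then ?z else prev_mark ?A ?z)"
    proof (rule prev_mark_subset[OF M])
      show "\<exists>y\<in>?A. fst y = fst x" using x by blast
    qed (use marks_bounds[OF A x] in auto)
    note x_eq = next_prev_mark[OF A x, unfolded this, symmetric]
    show ?thesis
    proof (cases "?z \<in> ?A")
      case True
      \<comment> \<open>A nonzero mismatch would have put a cut point between \<open>?z\<close> and
        \<open>x\<close>.\<close>
      have "N ?z = 0"
      proof (rule ccontr)
        assume N: "N ?z \<noteq> 0"
        then have "af ?z \<in> ?M" using True by (auto simp: C_af)
        moreover have "prev_mark ?M (af ?z) = ?z" using prev_M_af[OF True N] .
        ultimately have "af ?z = x" using M x by (metis UnI1 next_prev_mark)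
        then show False using af_A[OF True] x by simp
      qed
      then show ?thesis using z True x_eq by (simp add: f_def N_def)
    next
      case False
      then show ?thesis using z x_eq by (simp add: f_def)
    qed
  qed
  have "alexander_numbering D C f"
    unfolding alexander_numbering_def Let_def
  proof (intro conjI ballI)
    fix c assume "c \<in> C"
    then obtain x where x: "x \<in> ?A" "N x \<noteq> 0" "c = (af x, N x = 1)" by (auto simp: C_def)
    have "piece_to ?M (af x) = From x" using prev_M_af x by (auto simp: piece_to_mark C_af)
    moreover have "cut_sign c = N x" using x by (auto simp: cut_sign_def N_def inn_def out_def split: if_splits)
    ultimately show "f (From (fst c)) = f (piece_to ?M (fst c)) + cut_sign c"
      using x f_af by (simp add: N_def)
  next
    fix c assume c: "c \<in> classical D"
    obtain p q where pq: "c = (p, q)" by (cases c)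
    have "p \<in> ?A" "q \<in> ?A" using c pq by (force simp: classical_points_def)+
    moreover have "crossing_at D p = c" "crossing_at D q = c" "p \<noteq> q"
      using crossing_at_eq[OF vld c] classical_distinct[OF vld c] pq by auto
    ultimately show "case c of (p, q) \<Rightarrow> case if positive D (p, q) then (p, q) else (q, p) of (a, b) \<Rightarrow>
        \<exists>i. f (piece_to ?M a) = i \<and> f (From b) = i \<and> f (piece_to ?M b) = i + 1 \<and> f (From a) = i + 1"
      using pq by (auto simp: f_in f_af inn_def out_def crossing_sign_def)
  qed
  then show ?thesis using cp by (auto simp: cut_system_def)
qed

end

section \<open>State sums\<close>

abbreviation loop_factor :: mv_poly where
  "loop_factor \<equiv> - A_pow 2 - A_pow (- 2)"

lemma A_pow_mult: "A_pow m * A_pow n = A_pow (m + n)"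
  by (simp add: A_pow_add)

lemma A_pow_power: "A_pow m ^ k = A_pow (m * int k)"
  by (induct k) (simp_all add: A_pow_0 A_pow_mult algebra_simps)

lemma minus_A3_pow_eq: "minus_A3_pow n = (if even n then 1 else - 1) * A_pow (3 * n)"
proof -
  have *: "(- A_pow m) ^ k = (if even k then 1 else - 1) * A_pow (m * int k)" for m k
    by (simp add: power_minus[of "A_pow m"] A_pow_power)
  show ?thesis by (auto simp: minus_A3_pow_def * even_nat_iff)
qed

lemma minus_A3_pow_shift:
  "minus_A3_pow (n - 1) = minus_A3_pow n * - A_pow (- 3)"
  "minus_A3_pow (n + 1) = minus_A3_pow n * - A_pow 3"
  by (simp_all add: minus_A3_pow_eq mult.assoc A_pow_mult algebra_simps)

text \<open>The bracket of a kink: A(-A^2 - A^-2) + A^-1 = -A^3, and its mirror image.\<close>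

lemma loop_factor_mult:
  "A_pow (b + 1) * loop_factor + A_pow (b - 1) = A_pow b * - A_pow 3"
  "A_pow (b + 1) + A_pow (b - 1) * loop_factor = A_pow b * - A_pow (- 3)"
  by (simp_all add: right_diff_distrib A_pow_mult add.commute)

section \<open>Splitting a state sum at one crossing\<close>

context
  fixes D D' :: diagram and c :: crossing
  assumes fin: "finite (classical D')" and c: "c \<notin> classical D'"
    and classical: "classical D = insert c (classical D')"
begin

lemma sum_states_insert:
  "(\<Sum>\<sigma>\<in>states D. g \<sigma>) = (\<Sum>\<tau>\<in>states D'. g (\<tau>(c := A_splice)) + g (\<tau>(c := B_splice)))"
proof -
  have inj: "inj_on (\<lambda>(y, \<tau>). \<tau>(c := y)) ({A_splice, B_splice} \<times> states D')"
    unfolding states_def by (rule inj_combinator[OF c])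
  have "states D = (\<lambda>(y, \<tau>). \<tau>(c := y)) ` ({A_splice, B_splice} \<times> states D')"
    unfolding states_def classical by (rule PiE_insert_eq)
  then have "(\<Sum>\<sigma>\<in>states D. g \<sigma>) = (\<Sum>(y, \<tau>)\<in>{A_splice, B_splice} \<times> states D'. g (\<tau>(c := y)))"
    using sum.reindex[OF inj, of g] by (simp add: case_prod_unfold)
  also have "\<dots> = (\<Sum>\<tau>\<in>states D'. \<Sum>y\<in>{A_splice, B_splice}. g (\<tau>(c := y)))"
    by (subst sum.swap) (simp add: sum.cartesian_product)
  finally show ?thesis by simp
qed

lemma splice_balance_insert:
  "splice_balance D (\<tau>(c := A_splice)) = splice_balance D' \<tau> + 1"
  "splice_balance D (\<tau>(c := B_splice)) = splice_balance D' \<tau> - 1"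
proof -
  have set: "{x \<in> classical D. (\<tau>(c := s)) x = s'} =
      (if s = s' then insert c {x \<in> classical D'. \<tau> x = s'} else {x \<in> classical D'. \<tau> x = s'})"
    for s s' using c by (auto simp: classical)
  show "splice_balance D (\<tau>(c := A_splice)) = splice_balance D' \<tau> + 1"
    "splice_balance D (\<tau>(c := B_splice)) = splice_balance D' \<tau> - 1"
    unfolding splice_balance_def set using fin c by simp_all
qed

lemma writhe_insert:
  assumes "\<And>x. positive D x = positive D' x"
  shows "writhe D = writhe D' + (if positive D' c then 1 else - 1)"
proof -
  have set: "{x \<in> classical D. P x} =
      (if P c then insert c {x \<in> classical D'. P x} else {x \<in> classical D'. P x})" for P
    by (auto simp: classical)
  show ?thesis
    unfolding writhe_def assms set[of "positive D'"] set[of "\<lambda>x. \<not> positive D' x"]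
    using fin c by simp
qed

end

lemma state_term_almost_classical:
  assumes "virtual_link_diagram D" "almost_classical D" "cut_system D C"
  shows "state_term D C \<sigma> =
    A_pow (splice_balance D \<sigma>) * loop_factor ^ (card (state_loops D \<sigma>) - 1)"
proof -
  have "index_number D C \<sigma> i = 0" if "1 \<le> i" for i
  proof -
    have "{l \<in> state_loops D \<sigma>. loop_index D C \<sigma> l = i} = {}"
      using loop_index_almost_classical[OF assms] that by auto
    then show ?thesis by (simp only: index_number_def card.empty)
  qed
  then have "{i. 1 \<le> i \<and> index_number D C \<sigma> i \<noteq> 0} = {}" by auto
  then show ?thesis unfolding state_term_def by (simp only: prod.empty mult_1_right)
qed

lemma cut_system_some:
  assumes "virtual_link_diagram D"
  shows "cut_system D (SOME C. cut_system D C)"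
  using cut_system_exists[OF assms] by (rule someI_ex)

section \<open>Skein triples\<close>

context
  fixes Dp Dm Dv :: diagram and p q :: point and f :: "piece \<Rightarrow> int"
  assumes vld: "virtual_link_diagram Dp" "virtual_link_diagram Dm" "virtual_link_diagram Dv"
    and pq: "(p, q) \<in> classical Dp" "positive Dp (p, q)"
    and Dm: "Dm = Dp\<lparr>classical := insert (q, p) (classical Dp - {(p, q)})\<rparr>"
    and Dv: "Dv = Dp\<lparr>classical := classical Dp - {(p, q)}\<rparr>"
    and f: "alexander_numbering Dp {} f"
begin

section \<open>Common combinatorics of the three diagrams\<close>

lemma curves_eq: "curves Dm = curves Dp" "curves Dv = curves Dp"
  by (simp_all add: Dm Dv)

lemma positive_eq: "positive Dm c = positive Dp c" "positive Dv c = positive Dp c"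
  by (simp_all add: positive_def tangent_def curves_eq)

lemma not_positive_qp: "\<not> positive Dp (q, p)"
  using pq(2) by (simp add: positive_def cross2_def algebra_simps)

lemma p_neq_q: "p \<noteq> q"
  using classical_distinct[OF vld(1) pq(1)] by simp

lemma qp_notin: "(q, p) \<notin> classical Dp"
  using classical_unique[OF vld(1) pq(1), of "(q, p)" p] p_neq_q by auto

lemma classical_eq:
  "classical Dp = insert (p, q) (classical Dv)" "classical Dm = insert (q, p) (classical Dv)"
  "(p, q) \<notin> classical Dv" "(q, p) \<notin> classical Dv" "finite (classical Dv)"
  using pq(1) qp_notin finite_classical[OF vld(3)] by (auto simp: Dm Dv)

lemma classical_points_eq:
  "classical_points Dm = classical_points Dp"
  "classical_points Dv = classical_points Dp - {p, q}"
  "p \<in> classical_points Dp" "q \<in> classical_points Dp"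
proof -
  have "x \<noteq> p \<and> x \<noteq> q" if x: "x \<in> classical_points Dv" for x
  proof -
    obtain c where "c \<in> classical Dv" "x = fst c \<or> x = snd c"
      using x by (auto simp: classical_points_def)
    then show ?thesis
      using classical_unique[OF vld(1) pq(1), of c x] classical_eq(1,3) by auto
  qed
  then show "classical_points Dv = classical_points Dp - {p, q}"
    by (auto simp: classical_points_def classical_eq(1))
qed (auto simp: classical_points_def classical_eq(1,2))

lemma partner_pq: "partner Dp p = q" "partner Dp q = p" "partner Dm p = q" "partner Dm q = p"
  using partner_eq[OF vld(1) pq(1)] partner_eq[OF vld(2), of "(q, p)"] classical_eq(2) by auto

lemma crossing_at_pq:
  "crossing_at Dp p = (p, q)" "crossing_at Dp q = (p, q)"
  "crossing_at Dm p = (q, p)" "crossing_at Dm q = (q, p)"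
  using crossing_at_eq[OF vld(1) pq(1)] crossing_at_eq[OF vld(2), of "(q, p)"] classical_eq(2) by auto

lemma crossing_at_other:
  assumes "x \<in> classical_points Dv"
  shows "crossing_at Dp x = crossing_at Dv x" "crossing_at Dm x = crossing_at Dv x"
    "partner Dp x = partner Dv x" "partner Dm x = partner Dv x" "crossing_at Dv x \<in> classical Dv"
proof -
  note c = crossing_at_props[OF vld(3) assms]
  show *: "crossing_at Dp x = crossing_at Dv x" "crossing_at Dm x = crossing_at Dv x"
    using c by (intro crossing_at_eq[OF vld(1)] crossing_at_eq[OF vld(2)]; simp add: classical_eq(1,2))+
  show "partner Dp x = partner Dv x" "partner Dm x = partner Dv x" "crossing_at Dv x \<in> classical Dv"
    using c * by (simp_all add: partner_def)
qed

lemma ori_at_other: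
  assumes "x \<in> classical_points Dv"
  shows "ori_at Dp (\<tau>((p, q) := s)) x = ori_at Dv \<tau> x" "ori_at Dm (\<tau>((q, p) := s)) x = ori_at Dv \<tau> x"
  using crossing_at_other[OF assms] classical_eq(3,4)
  by (auto simp: ori_at_def oriented_splice_def positive_eq)

text \<open>As \<open>(p, q)\<close> is positive and \<open>(q, p)\<close> negative, the crossing
  change exchanges the roles of the A- and the B-splice.\<close>

lemma ori_at_pq:
  assumes "x = p \<or> x = q"
  shows "ori_at Dp (\<tau>((p, q) := s)) x \<longleftrightarrow> s = A_splice" "ori_at Dm (\<tau>((q, p) := s)) x \<longleftrightarrow> s = B_splice"
  using assms crossing_at_pq pq(2) not_positive_qp
  by (auto simp: ori_at_def oriented_splice_def positive_eq)

lemma marks_cases: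
  assumes "x \<in> classical_points Dp"
  obtains "x = p \<or> x = q" | "x \<in> classical_points Dv"
  using assms classical_points_eq by auto

text \<open>Parity is a colouring because a numbering jumps by 1 or -1 along each strand and agrees
  on pieces joined by the orientation-respecting splice.\<close>

lemma coloured:
  "coloured_loops (loop_count Dp) (classical_points Dp) (partner Dp) (ori_at Dp \<sigma>) (\<lambda>s. even (f s))"
proof (intro coloured_loops.intro coloured_loops_axioms.intro)
  show "marked_loops (loop_count Dp) (classical_points Dp) (partner Dp) (ori_at Dp \<sigma>)"
    by (rule diagram_marked_loops[OF vld(1)])
qed (use alexander_at_crossing[OF vld(1) f] in \<open>auto simp: crossing_sign_def\<close>)

text \<open>The four splices at the crossing of \<open>Dp\<close> and \<open>Dm\<close> amount to
  only two joins, given by \<open>ori\<close> and \<open>ori'\<close>, because the two diagrams have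
  the same points and partners.\<close>

lemma skein_loops:
  defines "A \<equiv> classical_points Dv"
  shows "\<exists>along.
    card (state_loops Dp (\<tau>((p, q) := A_splice))) = card (state_loops Dv \<tau>) + of_bool along \<and>
    card (state_loops Dp (\<tau>((p, q) := B_splice))) = card (state_loops Dv \<tau>) + of_bool (\<not> along) \<and>
    card (state_loops Dm (\<tau>((q, p) := A_splice))) = card (state_loops Dv \<tau>) + of_bool (\<not> along) \<and>
    card (state_loops Dm (\<tau>((q, p) := B_splice))) = card (state_loops Dv \<tau>) + of_bool along \<and>
    (\<forall>b. equivclp (djoin A (partner Dv) (ori_at Dv \<tau>) A) (piece_to A p, b) (piece_to A q, b = along))"
proof -
  let ?M = "classical_points Dp"
  define ori where "ori = ori_at Dp (\<tau>((p, q) := A_splice))"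
  define ori' where "ori' = ori(p := False, q := False)"
  interpret coloured_loops "loop_count Dp" ?M "partner Dp" ori "\<lambda>s. even (f s)"
    unfolding ori_def by (rule coloured)
  have A: "A = ?M - {p, q}" by (simp add: A_def classical_points_eq)
  have "ori p" by (simp add: ori_def ori_at_pq)
  note smoothings = smoothings_of_crossing[OF classical_points_eq(3) partner_pq(1) p_neq_q this, folded A ori'_def]
  have ori_A: "ori x = ori_at Dv \<tau> x" if "x \<in> A" for x
    using that ori_at_other by (simp add: ori_def A_def)
  have ori_M: "ori_at Dp (\<tau>((p, q) := B_splice)) x = ori' x"
    "ori_at Dm (\<tau>((q, p) := A_splice)) x = ori' x"
    "ori_at Dm (\<tau>((q, p) := B_splice)) x = ori x"
    "partner Dm x = partner Dp x" if "x \<in> ?M" for x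
  proof -
    have "ori_at Dp (\<tau>((p, q) := B_splice)) x = ori' x \<and> ori_at Dm (\<tau>((q, p) := A_splice)) x = ori' x \<and>
      ori_at Dm (\<tau>((q, p) := B_splice)) x = ori x \<and> partner Dm x = partner Dp x"
      using that
    proof (cases rule: marks_cases)
      case 1
      then show ?thesis
        using ori_at_pq[OF 1] partner_pq by (elim disjE) (simp_all add: ori_def ori'_def)
    next
      case 2
      then have "x \<noteq> p" "x \<noteq> q" using classical_points_eq(2) by auto
      then show ?thesis
        using ori_at_other[OF 2] crossing_at_other[OF 2] by (simp add: ori_def ori'_def)
    qed
    then show "ori_at Dp (\<tau>((p, q) := B_splice)) x = ori' x"
      "ori_at Dm (\<tau>((q, p) := A_splice)) x = ori' x"
      "ori_at Dm (\<tau>((q, p) := B_splice)) x = ori x"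
      "partner Dm x = partner Dp x" by blast+
  qed
  have j: "join A (partner Dp) ori A = join A (partner Dv) (ori_at Dv \<tau>) A"
    "djoin A (partner Dp) ori A = djoin A (partner Dv) (ori_at Dv \<tau>) A"
    by (rule join_cong djoin_cong; use ori_A crossing_at_other in \<open>simp add: A_def\<close>)+
  have loops_v: "card (comps (pieces_of (loop_count Dp) A) (join A (partner Dp) ori A)) = card (state_loops Dv \<tau>)"
    by (simp add: state_loops_eq[OF vld(3)] semi_arcs_eq[OF vld(3)] curves_eq A_def[symmetric] j)
  have jM: "join ?M (partner Dp) (ori_at Dp (\<tau>((p, q) := B_splice))) ?M = join ?M (partner Dp) ori' ?M"
    "join ?M (partner Dm) (ori_at Dm (\<tau>((q, p) := A_splice))) ?M = join ?M (partner Dp) ori' ?M"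
    "join ?M (partner Dm) (ori_at Dm (\<tau>((q, p) := B_splice))) ?M = join ?M (partner Dp) ori ?M"
    by (rule join_cong; use ori_M in simp)+
  have loops: "state_loops Dp (\<tau>((p, q) := A_splice)) = comps S (join ?M (partner Dp) ori ?M)"
    "state_loops Dp (\<tau>((p, q) := B_splice)) = comps S (join ?M (partner Dp) ori' ?M)"
    "state_loops Dm (\<tau>((q, p) := A_splice)) = comps S (join ?M (partner Dp) ori' ?M)"
    "state_loops Dm (\<tau>((q, p) := B_splice)) = comps S (join ?M (partner Dp) ori ?M)"
    unfolding state_loops_eq[OF vld(1)] semi_arcs_eq[OF vld(1)] state_loops_eq[OF vld(2)]
      semi_arcs_eq[OF vld(2)] curves_eq classical_points_eq(1) ori_def[symmetric] jM
    by (rule refl)+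
  obtain along where along:
    "card (comps S (join ?M (partner Dp) ori ?M)) =
      (if along then Suc (card (state_loops Dv \<tau>)) else card (state_loops Dv \<tau>))"
    "card (comps S (join ?M (partner Dp) ori' ?M)) =
      (if along then card (state_loops Dv \<tau>) else Suc (card (state_loops Dv \<tau>)))"
    "\<And>b. equivclp (djoin A (partner Dv) (ori_at Dv \<tau>) A) (piece_to A p, b) (piece_to A q, b = along)"
    using smoothings(2) unfolding loops_v j(2) by blast
  show ?thesis
    by (intro exI[of _ along] conjI allI along(3)) (simp_all add: loops along(1,2))
qed

text \<open>The numbering \<open>f\<close> of \<open>Dp\<close> satisfies the conditions at the
  crossings of \<open>Dv\<close>, but on a semi-arc of \<open>Dv\<close> it may jump at
  \<open>p\<close> or \<open>q\<close>. It therefore enters through separate values before and after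
  each crossing, and its jumps stand in for cut points.\<close>

lemma skein_weight:
  fixes \<tau> :: state
  assumes C: "cut_system Dv C" and z: "fst z \<in> semi_arcs Dv"
  defines "A \<equiv> classical_points Dv" and "O' \<equiv> orbit (travel Dv \<tau>) z"
  shows "(\<Sum>w\<in>O'. cut_count Dv C w) =
    of_bool ((piece_to A p, True) \<in> O') - of_bool ((piece_to A p, False) \<in> O') -
    (of_bool ((piece_to A q, True) \<in> O') - of_bool ((piece_to A q, False) \<in> O'))"
proof -
  let ?M = "classical_points Dp"
  interpret marked_loops "loop_count Dv" A "partner Dv" "ori_at Dv \<tau>"
    unfolding A_def by (rule diagram_marked_loops[OF vld(3)])
  \<comment> \<open>The total jump of \<open>f\<close> on the semi-arc \<open>s\<close>: 1 at
    \<open>p\<close> and -1 at \<open>q\<close>, cancelling if both points lie on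
    \<open>s\<close>.\<close>
  define W where "W s = of_bool (piece_to A p = s) - (of_bool (piece_to A q = s) :: int)" for s
  have M: "marks ?M" using classical_points_marks[OF vld(1)] .
  have sub: "A \<subseteq> ?M" and diff: "?M - A = {p, q}" using classical_points_eq by (auto simp: A_def)
  have num: "f (From (partner Dp x)) = f (From (prev_mark ?M x))"
    "f (From x) = f (From (prev_mark ?M x)) + crossing_sign Dp x" if "x \<in> ?M" for x
    using alexander_at_crossing[OF vld(1) f that] that by (simp_all add: piece_to_mark)
  have signs: "crossing_sign Dp p = 1" "crossing_sign Dp q = - 1"
    using crossing_at_pq pq(2) p_neq_q by (auto simp: crossing_sign_def)
  have W: "W s = (\<Sum>m\<in>{m \<in> ?M - A. piece_to A m = s}. f (From m) - f (From (prev_mark ?M m)))" for s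
  proof -
    have set: "{m \<in> ?M - A. piece_to A m = s} =
        (if piece_to A p = s then {p} else {}) \<union> (if piece_to A q = s then {q} else {})"
      unfolding diff by auto
    show ?thesis unfolding set W_def
      using num(2)[OF classical_points_eq(3)] num(2)[OF classical_points_eq(4)] signs p_neq_q by auto
  qed
  have O': "(\<Sum>w\<in>O'. cut_count Dv C w) = (\<Sum>w\<in>O'. dir_sign w * W (fst w))"
    unfolding O'_def
  proof (rule sum_cut_count[OF vld(3) C z, folded A_def])
    fix x assume x: "x \<in> A"
    then have xM: "x \<in> ?M" using sub by blast
    note other = crossing_at_other[OF x[unfolded A_def]]
    show "f (From (partner Dv x)) = f (From (prev_mark ?M x))" using num(1)[OF xM] other by simp
    have "crossing_sign Dv x = crossing_sign Dp x"
      by (simp add: crossing_sign_def other positive_eq)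
    then show "f (From x) = f (From (prev_mark ?M x)) + crossing_sign Dv x"
      using num(2)[OF xM] by simp
    show "W (From x) = f (From (prev_mark ?M (next_mark A x))) - f (From x)"
      unfolding W by (rule sum_piece[OF M sub x])
  next
    show "W (Whole k) = 0" for k unfolding W by (rule sum_whole_loop[OF M sub])
  qed
  have fin: "finite O'"
    unfolding O'_def travel_eq[OF vld(3)]
    using finite_orbit self_in_orbit z semi_arcs_eq[OF vld(3)] A_def by metis
  have "(\<Sum>w\<in>O'. dir_sign w * of_bool (a = fst w)) =
      of_bool ((a, True) \<in> O') - (of_bool ((a, False) \<in> O') :: int)" for a
  proof -
    have "(\<Sum>w\<in>O'. dir_sign w * of_bool (a = fst w)) = (\<Sum>w\<in>O' \<inter> {(a, True), (a, False)}. dir_sign w)"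
      using fin by (intro sum.mono_neutral_cong_right) auto
    also have "\<dots> = of_bool ((a, True) \<in> O') - (of_bool ((a, False) \<in> O') :: int)"
      by (cases "(a, True) \<in> O'"; cases "(a, False) \<in> O'") (auto simp: Int_insert_right)
    finally show ?thesis .
  qed
  then show ?thesis
    unfolding O' W_def by (simp add: right_diff_distrib sum_subtractf)
qed

text \<open>A loop through \<open>p\<close> also passes \<open>q\<close>. With \<open>along\<close>,
  both are passed in the same sense and the jumps cancel; otherwise they add up to 2 or -2, whence a
  single factor \<open>d 1\<close>.\<close>

lemma state_term_virtual:
  assumes C: "cut_system Dv C"
  defines "A \<equiv> classical_points Dv"
  assumes along: "\<And>b. equivclp (djoin A (partner Dv) (ori_at Dv \<tau>) A)
    (piece_to A p, b) (piece_to A q, b = along)"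
  shows "card (state_loops Dv \<tau>) \<noteq> 0"
    and "state_term Dv C \<tau> = A_pow (splice_balance Dv \<tau>) *
      loop_factor ^ (card (state_loops Dv \<tau>) - 1) * (if along then 1 else d 1)"
proof -
  interpret marked_loops "loop_count Dv" A "partner Dv" "ori_at Dv \<tau>"
    unfolding A_def by (rule diagram_marked_loops[OF vld(3)])
  let ?p = "piece_to A p" and ?q = "piece_to A q"
  have S: "S = semi_arcs Dv" using semi_arcs_eq[OF vld(3)] by (simp add: A_def)
  have loops: "state_loops Dv \<tau> = (\<lambda>s. {t. equivclp (join A (partner Dv) (ori_at Dv \<tau>) A) s t}) ` S"
    unfolding state_loops_eq[OF vld(3)] comps_def semi_arcs_eq[OF vld(3)] A_def by (rule refl)
  have p_in: "?p \<in> S"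
  proof (cases "\<exists>y\<in>A. fst y = fst p")
    case True
    then have "prev_mark A p \<in> A" by (rule prev_mark_props(1)[OF marks])
    then show ?thesis using True by (auto simp: piece_to_def pieces_of_def image_iff)
  next
    case False
    have "fst p < loop_count Dv"
      using classical_points_double[OF vld(1) classical_points_eq(3)]
      by (auto simp: double_points_def points_def curves_eq)
    then show ?thesis using False by (auto simp: piece_to_def pieces_of_def image_iff)
  qed
  define l0 where "l0 = {t. equivclp (join A (partner Dv) (ori_at Dv \<tau>) A) ?p t}"
  have l0: "l0 \<in> state_loops Dv \<tau>" using p_in by (auto simp: loops l0_def)
  moreover have fin: "finite (state_loops Dv \<tau>)" using finite_pieces by (simp add: loops)
  ultimately show "card (state_loops Dv \<tau>) \<noteq> 0" by auto
  have index: "loop_index Dv C \<tau> l = of_bool (?p \<in> l \<and> \<not> along)" if l: "l \<in> state_loops Dv \<tau>" for l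
  proof -
    define s where "s = (SOME s. s \<in> l)"
    define O' where "O' = orbit (travel Dv \<tau>) (s, True)"
    have s: "s \<in> l" "s \<in> S" using loop_props[OF vld(3) l] by (auto simp: s_def S)
    have O': "O' = {w. equivclp (djoin A (partner Dv) (ori_at Dv \<tau>) A) (s, True) w}"
      unfolding O'_def travel_eq[OF vld(3)] A_def[symmetric] using orbit_trav[of "(s, True)"] s(2) by simp
    have l_O': "fst ` O' = l"
    proof -
      obtain t where t: "l = {u. equivclp (join A (partner Dv) (ori_at Dv \<tau>) A) t u}"
        using l by (auto simp: loops)
      then have "l = {u. equivclp (join A (partner Dv) (ori_at Dv \<tau>) A) s u}"
        using s(1) class_eq_iff[of "join A (partner Dv) (ori_at Dv \<tau>) A" t s] by simp
      then show ?thesis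
        unfolding O'_def travel_eq[OF vld(3)] A_def[symmetric] using fst_orbit_trav[OF s(2)] by simp
    qed
    have pq_O': "(?q, b = along) \<in> O' \<longleftrightarrow> (?p, b) \<in> O'" for b
      unfolding O' using along[of b] by (blast intro: equivclp_trans equivclp_sym)
    \<comment> \<open>A loop never runs through \<open>?p\<close> in both directions, so
      contributions of opposite directions cannot cancel.\<close>
    have both: "\<not> ((?p, True) \<in> O' \<and> (?p, False) \<in> O')"
    proof
      assume "(?p, True) \<in> O' \<and> (?p, False) \<in> O'"
      then have "equivclp (djoin A (partner Dv) (ori_at Dv \<tau>) A) (?p, True) (?p, False)"
        unfolding O' by (blast intro: equivclp_trans equivclp_sym)
      then show False
        using rev_notin_orbit[of "(?p, True)"] orbit_trav[of "(?p, True)"] p_in by simp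
    qed
    have p_l: "?p \<in> l \<longleftrightarrow> (?p, True) \<in> O' \<or> (?p, False) \<in> O'"
    proof
      assume "?p \<in> l"
      then obtain w where "w \<in> O'" "fst w = ?p" unfolding l_O'[symmetric] by auto
      then show "(?p, True) \<in> O' \<or> (?p, False) \<in> O'" by (cases w; cases "snd w") auto
    next
      assume "(?p, True) \<in> O' \<or> (?p, False) \<in> O'"
      then show "?p \<in> l" unfolding l_O'[symmetric] by (metis fst_conv image_eqI)
    qed
    have "loop_index Dv C \<tau> l = nat \<bar>\<Sum>w\<in>O'. cut_count Dv C w\<bar> div 2"
      by (simp add: loop_index_def O'_def s_def)
    also have "(\<Sum>w\<in>O'. cut_count Dv C w) =
        of_bool ((?p, True) \<in> O') - of_bool ((?p, False) \<in> O') -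
        (of_bool ((?q, True) \<in> O') - of_bool ((?q, False) \<in> O'))"
      unfolding O'_def A_def by (rule skein_weight[OF C]) (use s(2) S in simp)
    also have "nat \<bar>\<dots>\<bar> div 2 = of_bool (?p \<in> l \<and> \<not> along)"
      using pq_O'[of True] pq_O'[of False] both p_l by (cases along) auto
    finally show ?thesis .
  qed
  have unique: "l = l0" if l: "l \<in> state_loops Dv \<tau>" "?p \<in> l" for l
  proof -
    obtain t where t: "l = {u. equivclp (join A (partner Dv) (ori_at Dv \<tau>) A) t u}"
      using l(1) by (auto simp: loops)
    then show ?thesis
      using l(2) class_eq_iff[of "join A (partner Dv) (ori_at Dv \<tau>) A" t ?p] by (simp add: l0_def)
  qed
  have p_l0: "?p \<in> l0" by (simp add: l0_def)
  have number: "index_number Dv C \<tau> i = of_bool (i = 1 \<and> \<not> along)" if "1 \<le> i" for i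
  proof -
    have "loop_index Dv C \<tau> l = i \<longleftrightarrow> (i = 1 \<and> \<not> along) \<and> l = l0" if l: "l \<in> state_loops Dv \<tau>" for l
    proof -
      have p_iff: "?p \<in> l \<longleftrightarrow> l = l0" using unique[OF l] p_l0 by blast
      show ?thesis
        unfolding index[OF l] p_iff using \<open>1 \<le> i\<close> by (cases "l = l0 \<and> \<not> along") auto
    qed
    then have "{l \<in> state_loops Dv \<tau>. loop_index Dv C \<tau> l = i} = (if i = 1 \<and> \<not> along then {l0} else {})"
      using l0 by (cases "i = 1 \<and> \<not> along") auto
    then show ?thesis by (simp add: index_number_def)
  qed
  have "(\<Prod>i\<in>{i. 1 \<le> i \<and> index_number Dv C \<tau> i \<noteq> 0}. d i ^ index_number Dv C \<tau> i) =
      (if along then 1 else d 1)"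
  proof -
    have "{i. 1 \<le> i \<and> index_number Dv C \<tau> i \<noteq> 0} = (if along then {} else {1})"
      using number by (auto simp: of_bool_def split: if_splits)
    then show ?thesis using number[of 1] by simp
  qed
  then show "state_term Dv C \<tau> = A_pow (splice_balance Dv \<tau>) *
      loop_factor ^ (card (state_loops Dv \<tau>) - 1) * (if along then 1 else d 1)"
    by (simp only: state_term_def)
qed

lemma skein_state_terms:
  assumes Cp: "cut_system Dp Cp" "almost_classical Dp"
    and Cm: "cut_system Dm Cm" "almost_classical Dm" and Cv: "cut_system Dv Cv"
  shows "\<exists>K (x :: mv_poly) y z.
    state_term Dp Cp (\<tau>((p, q) := A_splice)) + state_term Dp Cp (\<tau>((p, q) := B_splice)) = K * x \<and>
    state_term Dm Cm (\<tau>((q, p) := A_splice)) + state_term Dm Cm (\<tau>((q, p) := B_splice)) = K * y \<and>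
    state_term Dv Cv \<tau> = K * z \<and>
    (x = - A_pow 3 \<and> y = - A_pow (- 3) \<and> z = 1 \<or> x = - A_pow (- 3) \<and> y = - A_pow 3 \<and> z = d 1)"
proof -
  obtain along where along:
    "card (state_loops Dp (\<tau>((p, q) := A_splice))) = card (state_loops Dv \<tau>) + of_bool along"
    "card (state_loops Dp (\<tau>((p, q) := B_splice))) = card (state_loops Dv \<tau>) + of_bool (\<not> along)"
    "card (state_loops Dm (\<tau>((q, p) := A_splice))) = card (state_loops Dv \<tau>) + of_bool (\<not> along)"
    "card (state_loops Dm (\<tau>((q, p) := B_splice))) = card (state_loops Dv \<tau>) + of_bool along"
    "\<And>b. equivclp (djoin (classical_points Dv) (partner Dv) (ori_at Dv \<tau>) (classical_points Dv))
      (piece_to (classical_points Dv) p, b) (piece_to (classical_points Dv) q, b = along)"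
    using skein_loops[of \<tau>] by blast
  note v = state_term_virtual[OF Cv along(5)]
  define b where "b = splice_balance Dv \<tau>"
  \<comment> \<open>Since there is at least one loop, the truncated difference
    \<open>card - 1\<close> is a genuine exponent \<open>n\<close>.\<close>
  obtain n where n: "card (state_loops Dv \<tau>) = Suc n" using v(1) by (cases "card (state_loops Dv \<tau>)") auto
  define K where "K = A_pow b * loop_factor ^ n"
  have p: "state_term Dp Cp (\<tau>((p, q) := A_splice)) = A_pow (b + 1) * loop_factor ^ (n + of_bool along)"
    "state_term Dp Cp (\<tau>((p, q) := B_splice)) = A_pow (b - 1) * loop_factor ^ (n + of_bool (\<not> along))"
    using state_term_almost_classical[OF vld(1) Cp(2,1)] along n
      splice_balance_insert[OF classical_eq(5,3,1)] by (simp_all add: b_def)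
  have m: "state_term Dm Cm (\<tau>((q, p) := A_splice)) = A_pow (b + 1) * loop_factor ^ (n + of_bool (\<not> along))"
    "state_term Dm Cm (\<tau>((q, p) := B_splice)) = A_pow (b - 1) * loop_factor ^ (n + of_bool along)"
    using state_term_almost_classical[OF vld(2) Cm(2,1)] along n
      splice_balance_insert[OF classical_eq(5,4,2)] by (simp_all add: b_def)
  have sums: "A_pow (b + 1) * (loop_factor * X) + A_pow (b - 1) * X = A_pow b * X * - A_pow 3"
    "A_pow (b + 1) * X + A_pow (b - 1) * (loop_factor * X) = A_pow b * X * - A_pow (- 3)" for X
    using loop_factor_mult[of b, THEN arg_cong[where f = "\<lambda>y. y * X"]]
    by (simp_all only: ring_distribs mult_ac)
  show ?thesis
  proof (cases along)
    case True
    then show ?thesis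
      using p m sums[of "loop_factor ^ n"] v(2) n
      by (intro exI[of _ K] exI[of _ "- A_pow 3"] exI[of _ "- A_pow (- 3)"] exI[of _ "1 :: mv_poly"])
        (simp add: K_def b_def[symmetric])
  next
    case False
    then show ?thesis
      using p m sums[of "loop_factor ^ n"] v(2) n
      by (intro exI[of _ K] exI[of _ "- A_pow (- 3)"] exI[of _ "- A_pow 3"] exI[of _ "d 1"])
        (simp add: K_def b_def[symmetric])
  qed
qed

end

text \<open>The two alternatives demand a + b = c and A^-6 a + A^6 b = c d_1 of the coefficients a,
  b, c of the three polynomials. For c = A^6 - A^-6 the solution is a = A^6 - d_1 and b = d_1 -
  A^-6.\<close>

lemma skein_identity:
  fixes K x y z w :: mv_poly
  assumes "x = - A_pow 3 \<and> y = - A_pow (- 3) \<and> z = 1 \<or> x = - A_pow (- 3) \<and> y = - A_pow 3 \<and> z = d 1"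
  shows "(A_pow 6 - d 1) * (w * - A_pow (- 3) * (K * x)) + (- A_pow (- 6) + d 1) * (w * - A_pow 3 * (K * y)) =
    (A_pow 6 - A_pow (- 6)) * (w * (K * z))"
proof -
  have "(A_pow 6 - d 1) * (- A_pow (- 3) * x) + (- A_pow (- 6) + d 1) * (- A_pow 3 * y) =
      (A_pow 6 - A_pow (- 6)) * z"
    using assms by (auto simp: A_pow_mult A_pow_0 algebra_simps)
  then have "(w * K) * ((A_pow 6 - d 1) * (- A_pow (- 3) * x) + (- A_pow (- 6) + d 1) * (- A_pow 3 * y)) =
      (w * K) * ((A_pow 6 - A_pow (- 6)) * z)" by simp
  then show ?thesis by (simp only: distrib_left mult_ac)
qed

theorem theorem3p1:
  fixes Dp Dm Dv :: diagram
  assumes "virtual_skein_triple Dp Dm Dv"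
    and "almost_classical Dp" and "almost_classical Dm"
  shows "(A_pow 6 - d 1) * multivariable_polynomial Dp
           + (- A_pow (- 6) + d 1) * multivariable_polynomial Dm
         = (A_pow 6 - A_pow (- 6)) * multivariable_polynomial Dv"
proof -
  obtain p q where vld: "virtual_link_diagram Dp" "virtual_link_diagram Dm" "virtual_link_diagram Dv"
    and pq: "(p, q) \<in> classical Dp" "positive Dp (p, q)"
    and Dm: "Dm = Dp\<lparr>classical := insert (q, p) (classical Dp - {(p, q)})\<rparr>"
    and Dv: "Dv = Dp\<lparr>classical := classical Dp - {(p, q)}\<rparr>"
    using assms(1) unfolding virtual_skein_triple_def by blast
  obtain f where f: "alexander_numbering Dp {} f" using assms(2) by (auto simp: almost_classical_def)
  note skein = vld pq Dm Dv f
  define Cp where "Cp = (SOME C. cut_system Dp C)"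
  define Cm where "Cm = (SOME C. cut_system Dm C)"
  define Cv where "Cv = (SOME C. cut_system Dv C)"
  have C: "cut_system Dp Cp" "cut_system Dm Cm" "cut_system Dv Cv"
    unfolding Cp_def Cm_def Cv_def using vld by (auto intro: cut_system_some)
  note cl = classical_eq[OF skein]
  \<comment> \<open>The different writhes produce the relative factors -A^-3 and -A^3 below.\<close>
  have "writhe Dp = writhe Dv + 1" "writhe Dm = writhe Dv - 1"
    using writhe_insert[OF cl(5,3,1)] writhe_insert[OF cl(5,4,2)] positive_eq[OF skein] pq(2)
      not_positive_qp[OF skein] by simp_all
  then have X: "multivariable_polynomial Dp =
      minus_A3_pow (- writhe Dv) * - A_pow (- 3) * (\<Sum>\<tau>\<in>states Dv.
        state_term Dp Cp (\<tau>((p, q) := A_splice)) + state_term Dp Cp (\<tau>((p, q) := B_splice)))"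
    "multivariable_polynomial Dm =
      minus_A3_pow (- writhe Dv) * - A_pow 3 * (\<Sum>\<tau>\<in>states Dv.
        state_term Dm Cm (\<tau>((q, p) := A_splice)) + state_term Dm Cm (\<tau>((q, p) := B_splice)))"
    using minus_A3_pow_shift[of "- writhe Dv"]
    unfolding multivariable_polynomial_def double_bracket_def Cp_def[symmetric] Cm_def[symmetric]
      sum_states_insert[OF cl(5,3,1)] sum_states_insert[OF cl(5,4,2)]
    by simp_all
  show ?thesis
    unfolding X multivariable_polynomial_def[of Dv] double_bracket_def Cv_def[symmetric]
      sum_distrib_left sum.distrib[symmetric]
  \<comment> \<open>Every state of \<open>Dp\<close> or \<open>Dm\<close> is a state \<tau> of
    \<open>Dv\<close> with one more splice, so the identity is checked for each \<tau>
    separately.\<close>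
  proof (rule sum.cong[OF refl])
    fix \<tau>
    obtain K x y z where K:
      "state_term Dp Cp (\<tau>((p, q) := A_splice)) + state_term Dp Cp (\<tau>((p, q) := B_splice)) = K * x"
      "state_term Dm Cm (\<tau>((q, p) := A_splice)) + state_term Dm Cm (\<tau>((q, p) := B_splice)) = K * y"
      "state_term Dv Cv \<tau> = K * z"
      "x = - A_pow 3 \<and> y = - A_pow (- 3) \<and> z = 1 \<or> x = - A_pow (- 3) \<and> y = - A_pow 3 \<and> z = d 1"
      using skein_state_terms[OF skein C(1) assms(2) C(2) assms(3) C(3), of \<tau>] by blast
    show "(A_pow 6 - d 1) * (minus_A3_pow (- writhe Dv) * - A_pow (- 3) *
        (state_term Dp Cp (\<tau>((p, q) := A_splice)) + state_term Dp Cp (\<tau>((p, q) := B_splice)))) +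
      (- A_pow (- 6) + d 1) * (minus_A3_pow (- writhe Dv) * - A_pow 3 *
        (state_term Dm Cm (\<tau>((q, p) := A_splice)) + state_term Dm Cm (\<tau>((q, p) := B_splice)))) =
      (A_pow 6 - A_pow (- 6)) * (minus_A3_pow (- writhe Dv) * state_term Dv Cv \<tau>)"
      unfolding K(1-3) by (rule skein_identity[OF K(4)])
  qed
qed

end
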